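(* Let $X$ be a Riemann surface, $\mathcal{V}$ a projectively flat holomorphic vector bundle of rank $n$ over $X$, and $A$ a generic meromorphic section of $\mathcal{V}$. Let $\mathcal{U}=\{U_i\}$ be an open cover of $X$ by (connected) coordinate charts, with coordinates $z_i$, each carrying a projectively flat trivialization of $\mathcal{V}$, such that $w(A)$ has no zeros or poles on $U_i\cap U_j$ for $i\neq j$. Let $A_i=A|_{U_i}$, and let $p_1^i,\dots,p_n^i$ be the meromorphic functions on $U_i$ such that $$A_i^{(n)}=p_1^iA_i^{(n-1)}+\cdots+p_n^iA_i$$ (derivatives with respect to $z_i$). Regard $p_1^i$ as the meromorphic $1$-form $p_1^i\,dz_i$ on $U_i$. Then the Wronskian line bundle $w(\mathcal{V})$ has transition functions $\lambda_{ij}=\dfrac{w(A_i)}{w(A_j)}$, one has $d\log\lambda_{ij}=p_1^i-p_1^j$ on $U_i\cap U_j$, and $$c_1(w(\mathcal{V}))=\left[\{p_1^i-p_1^j\}\right]\in\check{H}^1(\mathcal{U},\Omega^1).$$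
   Context: Riemann surfaces are connected. A holomorphic vector bundle $\mathcal{V}$ of rank $n$ over $X$ is projectively flat if there are an open cover $\{U_i\}$ of $X$ and holomorphic trivializations of $\mathcal{V}$ over the $U_i$ whose transition functions on $U_i\cap U_j$ have the form $\mu_{ij}T_{ij}$, with $\mu_{ij}:U_i\cap U_j\to\mathbb{C}^\times$ holomorphic and $T_{ij}\in GL_n(\mathbb{C})$ constant. Such a structure is regarded as fixed; a projectively flat trivialization means a local trivialization related to those of the structure by transition functions of this form. Local sections are written as row vectors of component functions, so $A_i=\mu_{ij}A_jT_{ij}$. On a coordinate chart with coordinate $z$ and a projectively flat trivialization, a meromorphic section $A$ has components $(a_1,\dots,a_n)$; its Wronskian matrix $W(A)$ is the $n\times n$ matrix whose $k$-th row is $(a_1^{(k-1)},\dots,a_n^{(k-1)})$ (derivatives in $z$), and $w(A)=\det W(A)$. $A$ is generic if $w(A)\not\equiv0$ (independent of choices). $w(A_i)$ denotes the Wronskian determinant computed on $U_i$ with its coordinate and trivialization. The divisor of $w(A)$ does not depend on the choices and gives a global divisor $\mathrm{div}(A)$ on $X$, whose class in $\mathrm{Pic}(X)$ is independent of the generic section $A$. The Wronskian line bundle $w(\mathcal{V})$ is the line bundle corresponding to this divisor class. $\Omega^1$ is the sheaf of holomorphic differentials. For a line bundle $L$ with transition cocycle $\lambda_{ij}$ on $\mathcal{U}$ (a line bundle of a divisor with local equations $s_i$ having $\lambda_{ij}=s_i/s_j$), $c_1(L)$ is represented in $\check{H}^1(\mathcal{U},\Omega^1)$ by the cocycle $\{d\log\lambda_{ij}\}$.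 *)

theory Defs
  imports
    "HOL-Complex_Analysis.Complex_Analysis"
    "HOL-Algebra.Coset"
    "Jordan_Normal_Form.Determinant"
begin

no_notation Finite_Cartesian_Product.vec_nth (infixl \<open>$\<close> 90)
hide_const (open) Determinants.det Finite_Cartesian_Product.vec Finite_Cartesian_Product.mat

section \<open>Riemann surfaces\<close>

type_synonym 'a chart = "'a set \<times> ('a \<Rightarrow> complex)"

record 'a surface =
  rs_top :: "'a topology"
  rs_atlas :: "'a chart set"

abbreviation points :: "'a surface \<Rightarrow> 'a set" where
  "points R \<equiv> topspace (rs_top R)"

definition is_chart :: "'a topology \<Rightarrow> 'a chart \<Rightarrow> bool" where
  "is_chart X = (\<lambda>(U, z). openin X U \<and> open (z ` U) \<and>
     homeomorphic_map (subtopology X U) (top_of_set (z ` U)) z)"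

definition chart_compatible :: "'a chart \<Rightarrow> 'a chart \<Rightarrow> bool" where
  "chart_compatible = (\<lambda>(U, z) (V, w).
     (w \<circ> inv_into U z) holomorphic_on z ` (U \<inter> V) \<and>
     (z \<circ> inv_into V w) holomorphic_on w ` (U \<inter> V))"

definition riemann_surface :: "'a surface \<Rightarrow> bool" where
  "riemann_surface R \<longleftrightarrow>
     points R \<noteq> {} \<and> connected_space (rs_top R) \<and> Hausdorff_space (rs_top R) \<and>
     (\<forall>c\<in>rs_atlas R. is_chart (rs_top R) c) \<and>
     (\<forall>c\<in>rs_atlas R. \<forall>d\<in>rs_atlas R. chart_compatible c d) \<and>
     (\<Union>c\<in>rs_atlas R. fst c) = points R"

(* the coordinate charts are the members of the maximal atlas *)
definition coord_chart :: "'a surface \<Rightarrow> 'a chart \<Rightarrow> bool" where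
  "coord_chart R c \<longleftrightarrow> is_chart (rs_top R) c \<and> (\<forall>d\<in>rs_atlas R. chart_compatible c d)"

definition holo_on :: "'a surface \<Rightarrow> 'a set \<Rightarrow> ('a \<Rightarrow> complex) \<Rightarrow> bool" where
  "holo_on R V f \<longleftrightarrow> (\<forall>(W, \<zeta>)\<in>rs_atlas R. (f \<circ> inv_into W \<zeta>) holomorphic_on \<zeta> ` (W \<inter> V))"

(* As for the library's meromorphic_on, values at a discrete set of points are arbitrary:
   the meromorphic function meant is the class of f modulo such changes. *)
definition mero_on :: "'a surface \<Rightarrow> 'a set \<Rightarrow> ('a \<Rightarrow> complex) \<Rightarrow> bool" where
  "mero_on R V f \<longleftrightarrow> (\<forall>(W, \<zeta>)\<in>rs_atlas R. (f \<circ> inv_into W \<zeta>) meromorphic_on \<zeta> ` (W \<inter> V))"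

(* The canonical representative of a meromorphic function: removable singularities removed, value 0
   at poles (remove_sings, without reference to a coordinate). Two meromorphic functions are equal
   iff their canonical representatives agree pointwise. *)
definition mero_val :: "'a surface \<Rightarrow> ('a \<Rightarrow> complex) \<Rightarrow> 'a \<Rightarrow> complex" where
  "mero_val R f x =
     (if \<exists>c. (f \<longlongrightarrow> c) (atin (rs_top R) x) then Lim (atin (rs_top R) x) f else 0)"

(* order of vanishing at x; it does not depend on the chart *)
definition ord_at :: "'a surface \<Rightarrow> ('a \<Rightarrow> complex) \<Rightarrow> 'a \<Rightarrow> int" where
  "ord_at R f x =
     (let (U, z) = (SOME c. coord_chart R c \<and> x \<in> fst c) in zorder (f \<circ> inv_into U z) (z x))"

(* k-th derivative with respect to the coordinate z *)
definition coord_deriv :: "'a chart \<Rightarrow> nat \<Rightarrow> ('a \<Rightarrow> complex) \<Rightarrow> 'a \<Rightarrow> complex" where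
  "coord_deriv = (\<lambda>(U, z) k f x. (deriv ^^ k) (f \<circ> inv_into U z) (z x))"

section \<open>Holomorphic vector bundles\<close>

(* The second component of a trivialization over U sends a point of the total space to its
   (row) vector of components. The linear structure of the fibres and the complex structure of the
   total space are those transported by the trivializations. *)
type_synonym ('a, 'e) triv = "'a set \<times> ('e \<Rightarrow> complex vec)"

record ('a, 'e) vbundle =
  total :: "'e set"
  proj :: "'e \<Rightarrow> 'a"
  trivs :: "('a, 'e) triv set"

definition fibre :: "('a, 'e) vbundle \<Rightarrow> 'a \<Rightarrow> 'e set" where
  "fibre E x = {e \<in> total E. proj E e = x}"

definition is_triv :: "'a surface \<Rightarrow> nat \<Rightarrow> ('a, 'e) vbundle \<Rightarrow> ('a, 'e) triv \<Rightarrow> bool" where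
  "is_triv R n E = (\<lambda>(U, \<phi>). openin (rs_top R) U \<and>
     (\<forall>x\<in>U. bij_betw \<phi> (fibre E x) (carrier_vec n)))"

(* Components are row vectors: A_i = A_j g is written with the transpose of g. *)
definition triv_compatible ::
    "'a surface \<Rightarrow> nat \<Rightarrow> ('a, 'e) vbundle \<Rightarrow> ('a, 'e) triv \<Rightarrow> ('a, 'e) triv \<Rightarrow> bool" where
  "triv_compatible R n E = (\<lambda>(U, \<phi>) (V, \<psi>). \<exists>g.
     (\<forall>x\<in>U \<inter> V. g x \<in> carrier_mat n n \<and> invertible_mat (g x) \<and>
        (\<forall>e\<in>fibre E x. \<phi> e = transpose_mat (g x) *\<^sub>v \<psi> e)) \<and>
     (\<forall>k<n. \<forall>l<n. holo_on R (U \<inter> V) (\<lambda>x. g x $$ (k, l))))"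

definition holomorphic_bundle :: "'a surface \<Rightarrow> nat \<Rightarrow> ('a, 'e) vbundle \<Rightarrow> bool" where
  "holomorphic_bundle R n E \<longleftrightarrow>
     proj E ` total E \<subseteq> points R \<and>
     (\<forall>t\<in>trivs E. is_triv R n E t) \<and>
     (\<forall>t\<in>trivs E. \<forall>s\<in>trivs E. triv_compatible R n E t s) \<and>
     (\<Union>t\<in>trivs E. fst t) = points R"

definition holo_triv :: "'a surface \<Rightarrow> nat \<Rightarrow> ('a, 'e) vbundle \<Rightarrow> ('a, 'e) triv \<Rightarrow> bool" where
  "holo_triv R n E t \<longleftrightarrow> is_triv R n E t \<and> (\<forall>s\<in>trivs E. triv_compatible R n E t s)"

(* a set-theoretic section whose components are meromorphic; its values at the poles are arbitrary *)
definition mero_section :: "'a surface \<Rightarrow> nat \<Rightarrow> ('a, 'e) vbundle \<Rightarrow> ('a \<Rightarrow> 'e) \<Rightarrow> bool" where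
  "mero_section R n E A \<longleftrightarrow>
     (\<forall>x\<in>points R. A x \<in> fibre E x) \<and>
     (\<forall>(U, \<phi>)\<in>trivs E. \<forall>l<n. mero_on R U (\<lambda>x. \<phi> (A x) $ l))"

section \<open>Projectively flat structures\<close>

definition proj_flat_related ::
    "'a surface \<Rightarrow> nat \<Rightarrow> ('a, 'e) vbundle \<Rightarrow> ('a, 'e) triv \<Rightarrow> ('a, 'e) triv \<Rightarrow> bool" where
  "proj_flat_related R n E = (\<lambda>(U, \<phi>) (V, \<psi>). \<exists>\<mu> T.
     T \<in> carrier_mat n n \<and> invertible_mat T \<and>
     holo_on R (U \<inter> V) \<mu> \<and> (\<forall>x\<in>U \<inter> V. \<mu> x \<noteq> 0) \<and>
     (\<forall>x\<in>U \<inter> V. \<forall>e\<in>fibre E x. \<phi> e = \<mu> x \<cdot>\<^sub>v (transpose_mat T *\<^sub>v \<psi> e)))"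

definition proj_flat_structure ::
    "'a surface \<Rightarrow> nat \<Rightarrow> ('a, 'e) vbundle \<Rightarrow> ('a, 'e) triv set \<Rightarrow> bool" where
  "proj_flat_structure R n E P \<longleftrightarrow>
     (\<forall>t\<in>P. holo_triv R n E t) \<and>
     (\<forall>t\<in>P. \<forall>s\<in>P. proj_flat_related R n E t s) \<and>
     (\<Union>t\<in>P. fst t) = points R"

definition proj_flat_triv ::
    "'a surface \<Rightarrow> nat \<Rightarrow> ('a, 'e) vbundle \<Rightarrow> ('a, 'e) triv set \<Rightarrow> ('a, 'e) triv \<Rightarrow> bool" where
  "proj_flat_triv R n E P t \<longleftrightarrow> holo_triv R n E t \<and> (\<forall>s\<in>P. proj_flat_related R n E t s)"

section \<open>Wronskians\<close>

definition wronskian_matrix ::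
    "nat \<Rightarrow> 'a chart \<Rightarrow> ('e \<Rightarrow> complex vec) \<Rightarrow> ('a \<Rightarrow> 'e) \<Rightarrow> 'a \<Rightarrow> complex mat" where
  "wronskian_matrix n c \<phi> A x = mat n n (\<lambda>(k, l). coord_deriv c k (\<lambda>y. \<phi> (A y) $ l) x)"

(* The canonical representative matters: w(A) may be holomorphic at a pole of A. *)
definition wronskian ::
    "'a surface \<Rightarrow> nat \<Rightarrow> 'a chart \<Rightarrow> ('e \<Rightarrow> complex vec) \<Rightarrow> ('a \<Rightarrow> 'e) \<Rightarrow> 'a \<Rightarrow> complex" where
  "wronskian R n c \<phi> A = mero_val R (\<lambda>x. det (wronskian_matrix n c \<phi> A x))"

definition generic_section ::
    "'a surface \<Rightarrow> nat \<Rightarrow> ('a, 'e) vbundle \<Rightarrow> ('a, 'e) triv set \<Rightarrow> ('a \<Rightarrow> 'e) \<Rightarrow> bool" where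
  "generic_section R n E P A \<longleftrightarrow> mero_section R n E A \<and>
     (\<exists>U z \<phi>. coord_chart R (U, z) \<and> proj_flat_triv R n E P (U, \<phi>) \<and>
        (\<exists>x\<in>U. wronskian R n (U, z) \<phi> A x \<noteq> 0))"

(* div(A); independent of the chart and of the projectively flat trivialization around x *)
definition section_divisor ::
    "'a surface \<Rightarrow> nat \<Rightarrow> ('a, 'e) vbundle \<Rightarrow> ('a, 'e) triv set \<Rightarrow> ('a \<Rightarrow> 'e) \<Rightarrow> 'a \<Rightarrow> int" where
  "section_divisor R n E P A x =
     (let (U, z, \<phi>) = (SOME (U, z, \<phi>).
            coord_chart R (U, z) \<and> proj_flat_triv R n E P (U, \<phi>) \<and> x \<in> U)
      in ord_at R (wronskian R n (U, z) \<phi> A) x)"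

section \<open>Line bundles\<close>

(* The line bundle glued from the U k times C along the cocycle g. A point over x is the family u of
   its fibre coordinates u k = g k k' x * u k'; u is 0 at the indices without a coordinate at x. *)
definition glued_line_bundle ::
    "'a surface \<Rightarrow> 'k set \<Rightarrow> ('k \<Rightarrow> 'a set) \<Rightarrow> ('k \<Rightarrow> 'k \<Rightarrow> 'a \<Rightarrow> complex)
      \<Rightarrow> ('a, 'a \<times> ('k \<Rightarrow> complex)) vbundle" where
  "glued_line_bundle R K U g =
     \<lparr> total = {(x, u). x \<in> points R \<and>
          (\<forall>k. \<not> (k \<in> K \<and> x \<in> U k) \<longrightarrow> u k = 0) \<and>
          (\<forall>k\<in>K. \<forall>k'\<in>K. x \<in> U k \<inter> U k' \<longrightarrow> u k = g k k' x * u k')},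
       proj = fst,
       trivs = (\<lambda>k. (U k, \<lambda>(x, u). vec 1 (\<lambda>_. u k))) ` K \<rparr>"

definition local_equations :: "'a surface \<Rightarrow> ('a \<Rightarrow> int) \<Rightarrow> ('a set \<times> ('a \<Rightarrow> complex)) set" where
  "local_equations R D = {(V, s). openin (rs_top R) V \<and> mero_on R V s \<and>
     (\<forall>x\<in>V. \<not> (\<forall>\<^sub>F y in atin (rs_top R) x. s y = 0) \<and> ord_at R s x = D x)}"

definition divisor_line_bundle :: "'a surface \<Rightarrow> ('a \<Rightarrow> int)
      \<Rightarrow> ('a, 'a \<times> ('a set \<times> ('a \<Rightarrow> complex) \<Rightarrow> complex)) vbundle" where
  "divisor_line_bundle R D = glued_line_bundle R (local_equations R D) fst
     (\<lambda>(V, s) (V', s'). mero_val R (\<lambda>x. s x / s' x))"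

(* the divisor class does not depend on the generic section that is chosen *)
definition wronskian_line_bundle ::
    "'a surface \<Rightarrow> nat \<Rightarrow> ('a, 'e) vbundle \<Rightarrow> ('a, 'e) triv set
      \<Rightarrow> ('a, 'a \<times> ('a set \<times> ('a \<Rightarrow> complex) \<Rightarrow> complex)) vbundle" where
  "wronskian_line_bundle R n E P =
     divisor_line_bundle R (section_divisor R n E P (SOME A. generic_section R n E P A))"

definition has_transition_functions ::
    "'a surface \<Rightarrow> ('a, 'l) vbundle \<Rightarrow> 'i set \<Rightarrow> ('i \<Rightarrow> 'a set) \<Rightarrow> ('i \<Rightarrow> 'i \<Rightarrow> 'a \<Rightarrow> complex) \<Rightarrow> bool"
    where
  "has_transition_functions R L I U g \<longleftrightarrow>
     (\<forall>i\<in>I. \<forall>j\<in>I. holo_on R (U i \<inter> U j) (g i j) \<and> (\<forall>x\<in>U i \<inter> U j. g i j x \<noteq> 0)) \<and>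
     (\<exists>\<psi>. (\<forall>i\<in>I. holo_triv R 1 L (U i, \<psi> i)) \<and>
          (\<forall>i\<in>I. \<forall>j\<in>I. \<forall>x\<in>U i \<inter> U j. \<forall>e\<in>fibre L x. \<psi> i e = g i j x \<cdot>\<^sub>v \<psi> j e))"

section \<open>Differential forms and the first Chern class\<close>

(* A 1-form on V is the family of its coefficients f in the coordinates (f dz in the chart z); as a
   normal form, coefficients are 0 off V and off the charts. *)
type_synonym 'a form = "'a chart \<Rightarrow> 'a \<Rightarrow> complex"

definition holo_forms :: "'a surface \<Rightarrow> 'a set \<Rightarrow> 'a form set" where
  "holo_forms R V = {\<omega>.
     (\<forall>c x. \<not> (coord_chart R c \<and> x \<in> fst c \<inter> V) \<longrightarrow> \<omega> c x = 0) \<and>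
     (\<forall>W \<zeta>. coord_chart R (W, \<zeta>) \<longrightarrow> holo_on R (W \<inter> V) (\<omega> (W, \<zeta>))) \<and>
     (\<forall>W \<zeta> W' \<zeta>'. coord_chart R (W, \<zeta>) \<longrightarrow> coord_chart R (W', \<zeta>') \<longrightarrow>
        (\<forall>x\<in>W \<inter> W' \<inter> V. \<omega> (W, \<zeta>) x = \<omega> (W', \<zeta>') x * coord_deriv (W, \<zeta>) 1 \<zeta>' x))}"

(* the 1-form f dg on V *)
definition fun_diff :: "'a surface \<Rightarrow> 'a set \<Rightarrow> ('a \<Rightarrow> complex) \<Rightarrow> ('a \<Rightarrow> complex) \<Rightarrow> 'a form" where
  "fun_diff R V f g = (\<lambda>c x.
     if coord_chart R c \<and> x \<in> fst c \<inter> V then f x * coord_deriv c 1 g x else 0)"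

definition dlog :: "'a surface \<Rightarrow> 'a set \<Rightarrow> ('a \<Rightarrow> complex) \<Rightarrow> 'a form" where
  "dlog R V g = fun_diff R V (\<lambda>x. 1 / g x) g"

definition form_restrict :: "'a set \<Rightarrow> 'a form \<Rightarrow> 'a form" where
  "form_restrict V \<omega> = (\<lambda>c x. if x \<in> V then \<omega> c x else 0)"

definition form_add :: "'a form \<Rightarrow> 'a form \<Rightarrow> 'a form" where
  "form_add \<omega> \<eta> = (\<lambda>c x. \<omega> c x + \<eta> c x)"

definition form_diff :: "'a form \<Rightarrow> 'a form \<Rightarrow> 'a form" where
  "form_diff \<omega> \<eta> = (\<lambda>c x. \<omega> c x - \<eta> c x)"

definition form_zero :: "'a form" where
  "form_zero = (\<lambda>c x. 0)"

(* a family indexed by pairs in I, extended by zero *)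
definition cochain :: "'i set \<Rightarrow> ('i \<Rightarrow> 'i \<Rightarrow> 'a form) \<Rightarrow> 'i \<Rightarrow> 'i \<Rightarrow> 'a form" where
  "cochain I \<omega> = (\<lambda>i j. if i \<in> I \<and> j \<in> I then \<omega> i j else form_zero)"

(* the group of Cech 1-cocycles of the cover U with values in the sheaf of holomorphic 1-forms *)
definition cech_Z1 :: "'a surface \<Rightarrow> 'i set \<Rightarrow> ('i \<Rightarrow> 'a set) \<Rightarrow> ('i \<Rightarrow> 'i \<Rightarrow> 'a form) monoid" where
  "cech_Z1 R I U =
     \<lparr> carrier = {\<omega>.
         (\<forall>i j. \<not> (i \<in> I \<and> j \<in> I) \<longrightarrow> \<omega> i j = form_zero) \<and>
         (\<forall>i\<in>I. \<forall>j\<in>I. \<omega> i j \<in> holo_forms R (U i \<inter> U j)) \<and>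
         (\<forall>i\<in>I. \<forall>j\<in>I. \<forall>k\<in>I. let V = U i \<inter> U j \<inter> U k in
            form_add (form_restrict V (\<omega> i j)) (form_restrict V (\<omega> j k))
              = form_restrict V (\<omega> i k))},
       mult = (\<lambda>\<omega> \<eta> i j. form_add (\<omega> i j) (\<eta> i j)),
       one = (\<lambda>i j. form_zero) \<rparr>"

definition cech_B1 :: "'a surface \<Rightarrow> 'i set \<Rightarrow> ('i \<Rightarrow> 'a set) \<Rightarrow> ('i \<Rightarrow> 'i \<Rightarrow> 'a form) set" where
  "cech_B1 R I U =
     {cochain I (\<lambda>i j. form_diff (form_restrict (U i \<inter> U j) (\<eta> j)) (form_restrict (U i \<inter> U j) (\<eta> i)))
       | \<eta>. \<forall>i\<in>I. \<eta> i \<in> holo_forms R (U i)}"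

definition cech_H1 ::
    "'a surface \<Rightarrow> 'i set \<Rightarrow> ('i \<Rightarrow> 'a set) \<Rightarrow> ('i \<Rightarrow> 'i \<Rightarrow> 'a form) set monoid" where
  "cech_H1 R I U = cech_Z1 R I U Mod cech_B1 R I U"

definition cech_class ::
    "'a surface \<Rightarrow> 'i set \<Rightarrow> ('i \<Rightarrow> 'a set) \<Rightarrow> ('i \<Rightarrow> 'i \<Rightarrow> 'a form) \<Rightarrow> ('i \<Rightarrow> 'i \<Rightarrow> 'a form) set" where
  "cech_class R I U \<omega> = cech_B1 R I U #>\<^bsub>cech_Z1 R I U\<^esub> \<omega>"

(* c_1(L) in H^1(U, Omega^1), for a line bundle L trivial over the members of the cover U *)
definition chern_class ::
    "'a surface \<Rightarrow> 'i set \<Rightarrow> ('i \<Rightarrow> 'a set) \<Rightarrow> ('a, 'l) vbundle \<Rightarrow> ('i \<Rightarrow> 'i \<Rightarrow> 'a form) set" where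
  "chern_class R I U L = (THE c. \<exists>g. has_transition_functions R L I U g \<and>
     c = cech_class R I U (cochain I (\<lambda>i j. dlog R (U i \<inter> U j) (g i j))))"

end

(* In a chart and a projectively flat trivialization, let W be the matrix of derivatives of the
   components of a section.  For a second chart and trivialization, with matrix V, one has W = M V T,
   where T is the constant matrix of the trivializations and M is lower triangular; its entries are
   holomorphic and do not depend on the section, and its diagonal entries are mu times powers of the
   derivative of the coordinate change.  Hence det W / det V is a nowhere vanishing holomorphic
   function that is the same for all sections.  So the functions w(A_i), for the section chosen in
   the definition of the Wronskian bundle, are local equations of its divisor, and their quotients
   are the lambda_ij of every generic section.  Genericity spreads from one point to all of X because
   X is connected.

   Differentiating det W row by row leaves only the term in which the last row is differentiated,
   so dw/dz = p_1 w.  Off the zeros and poles of w this reads d log w(A_i) = p_1^i dz_i. *)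

theory Submission
  imports Defs
begin

text \<open>The components of a section, and with them its Wronskian determinant, have arbitrary
  values on a discrete set. Identities therefore hold only in punctured neighbourhoods
  (\<open>atin\<close>): calculus is done at nearby points where the finitely many functions
  involved are holomorphic, and \<open>mero_val\<close> carries the result to the point itself as a
  limit.

  Projective flatness enters through constancy: T passes through every derivative, and the remaining
  coefficients involve only \<open>\<mu>\<close> and the two coordinates.

  The Chern class is a definite description, so every system of transition functions over the cover
  must be shown to give the same class. Two systems differ by nowhere zero holomorphic functions
  h_i, whose logarithmic differentials supply a coboundary. The forms p_1^i dz_i may have poles on
  U_i, so their differences need not be a coboundary of holomorphic forms.\<close>

lemma invertible_mat_det_nonzero:
  fixes T :: "'b :: comm_ring_1 mat"
  assumes T: "T \<in> carrier_mat n n" "invertible_mat T"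
  shows "det T \<noteq> 0"
proof -
  obtain B where B: "T * B = 1\<^sub>m n" "B * T = 1\<^sub>m (dim_row B)"
    using T by (auto simp: invertible_mat_def inverts_mat_def)
  \<comment> \<open>\<open>inverts_mat\<close> does not state the shape of B; its dimensions are
    read off the two products.\<close>
  have "dim_col B = n" using arg_cong[OF B(1), of dim_col] by simp
  moreover have "dim_row B = n" using arg_cong[OF B(2), of dim_col] T by simp
  ultimately have "B \<in> carrier_mat n n" by auto
  then have "det T * det B = 1" using det_mult[OF T(1), of B, symmetric] B(1) by simp
  then show ?thesis by auto
qed

lemma transpose_1x1_mult:
  fixes g :: "complex mat"
  assumes "g \<in> carrier_mat 1 1" "v \<in> carrier_vec 1"
  shows "transpose_mat g *\<^sub>v v = g $$ (0, 0) \<cdot>\<^sub>v v"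
  using assms by (intro eq_vecI) (auto simp: scalar_prod_def)

lemma invertible_mat_1x1:
  fixes k :: complex
  assumes "k \<noteq> 0" shows "invertible_mat (mat 1 1 (\<lambda>_. k))"
proof -
  have "mat 1 1 (\<lambda>_. k) * mat 1 1 (\<lambda>_. 1 / k) = 1\<^sub>m 1" "mat 1 1 (\<lambda>_. 1 / k) * mat 1 1 (\<lambda>_. k) = 1\<^sub>m 1"
    using assms by (auto intro!: eq_matI simp: scalar_prod_def)
  then show ?thesis
    unfolding invertible_mat_def inverts_mat_def by (intro conjI exI[of _ "mat 1 1 (\<lambda>_. 1 / k)"]) auto
qed

text \<open>For a second coordinate \<open>w\<close> on the chart \<open>c\<close>, these are the coefficients in
  \<open>(\<mu> f)\<^sup>(\<^sup>k\<^sup>) = \<Sum>\<^sub>j leibniz_coeff c w \<mu> k j \<cdot> d\<^sup>jf/dw\<^sup>j\<close>, the derivative on the left being with respect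
  to the coordinate of \<open>c\<close>.\<close>

primrec leibniz_coeff ::
    "'a chart \<Rightarrow> ('a \<Rightarrow> complex) \<Rightarrow> ('a \<Rightarrow> complex) \<Rightarrow> nat \<Rightarrow> nat \<Rightarrow> 'a \<Rightarrow> complex" where
  "leibniz_coeff c w \<mu> 0 = (\<lambda>j y. if j = 0 then \<mu> y else 0)"
| "leibniz_coeff c w \<mu> (Suc k) = (\<lambda>j y. coord_deriv c 1 (leibniz_coeff c w \<mu> k j) y +
     (if j = 0 then 0 else leibniz_coeff c w \<mu> k (j - 1) y * coord_deriv c 1 w y))"

section \<open>Local analysis on a Riemann surface\<close>

locale riem_surface =
  fixes R :: "'a surface"
  assumes riemann: "riemann_surface R"
begin

abbreviation X where "X \<equiv> rs_top R"

text \<open>Holomorphy and meromorphy as properties of the germ at a point, so that limits,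
  quotients and chart changes can be treated one point at a time. A single chart is enough, since
  \<open>hol_at_chart\<close> and \<open>mer_at_chart\<close> move to any other;
  \<open>holo_on_iff\<close> and \<open>mero_on_iff\<close> return to sets.\<close>

definition hol_at :: "('a \<Rightarrow> complex) \<Rightarrow> 'a \<Rightarrow> bool" where
  "hol_at f x \<longleftrightarrow> (\<exists>U z. coord_chart R (U, z) \<and> x \<in> U \<and> (f \<circ> inv_into U z) analytic_on {z x})"

definition mer_at :: "('a \<Rightarrow> complex) \<Rightarrow> 'a \<Rightarrow> bool" where
  "mer_at f x \<longleftrightarrow> (\<exists>U z. coord_chart R (U, z) \<and> x \<in> U \<and> (f \<circ> inv_into U z) meromorphic_on {z x})"

section \<open>Charts of the maximal atlas and the filters they transport\<close>

lemma atlas_coord_chart: "c \<in> rs_atlas R \<Longrightarrow> coord_chart R c"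
  using riemann by (simp add: coord_chart_def riemann_surface_def)

lemma atlas_cover:
  assumes "x \<in> points R"
  obtains U z where "(U, z) \<in> rs_atlas R" "x \<in> U"
proof -
  have "x \<in> (\<Union>c\<in>rs_atlas R. fst c)"
    using riemann assms unfolding riemann_surface_def by metis
  then show thesis using that by auto
qed

lemma chart_cover:
  assumes "x \<in> points R"
  obtains U z where "coord_chart R (U, z)" "x \<in> U"
  by (rule atlas_cover[OF assms]) (rule that, rule atlas_coord_chart)

lemma chart_openin: "coord_chart R (U, z) \<Longrightarrow> openin X U"
  by (simp add: coord_chart_def is_chart_def)

lemma chart_points: "coord_chart R (U, z) \<Longrightarrow> x \<in> U \<Longrightarrow> x \<in> points R"
  using chart_openin openin_subset by blast

lemma chart_open_range: "coord_chart R (U, z) \<Longrightarrow> open (z ` U)"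
  by (simp add: coord_chart_def is_chart_def)

lemma chart_homeo:
  "coord_chart R (U, z) \<Longrightarrow> homeomorphic_map (subtopology X U) (top_of_set (z ` U)) z"
  by (simp add: coord_chart_def is_chart_def)

lemma chart_inj:
  assumes "coord_chart R (U, z)" shows "inj_on z U"
proof -
  have "topspace (subtopology X U) = U"
    using chart_openin[OF assms] openin_subset by fastforce
  then show ?thesis
    using homeomorphic_imp_injective_map[OF chart_homeo[OF assms]] by simp
qed

lemma chart_inv [simp]: "coord_chart R (U, z) \<Longrightarrow> x \<in> U \<Longrightarrow> inv_into U z (z x) = x"
  by (simp add: chart_inj)

lemma chart_image_open:
  assumes c: "coord_chart R (U, z)" and S: "openin X S" "S \<subseteq> U"
  shows "open (z ` S)"
proof -
  have "openin (subtopology X U) S"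
    using S by (simp add: openin_open_subtopology[OF chart_openin[OF c]])
  then have "openin (top_of_set (z ` U)) (z ` S)"
    using chart_homeo[OF c] homeomorphic_imp_open_map open_map_def by blast
  then show ?thesis
    using chart_open_range[OF c] openin_open_trans by blast
qed

text \<open>A chart is a homeomorphism onto an open set: open images give one direction, preimages
  the other. This and \<open>atin_chart\<close> carry filters of the surface to the plane, where
  complex analysis applies.\<close>

lemma eventually_nhdsin_chart:
  assumes c: "coord_chart R (U, z)" and x: "x \<in> U"
  shows "eventually P (nhdsin X x) \<longleftrightarrow> eventually (\<lambda>w. P (inv_into U z w)) (nhds (z x))"
proof
  assume "eventually P (nhdsin X x)"
  then obtain S where S: "openin X S" "x \<in> S" "\<forall>y\<in>S. P y"
    using chart_points[OF c x] by (auto simp: eventually_nhdsin)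
  have "open (z ` (S \<inter> U))"
    using chart_image_open[OF c, of "S \<inter> U"] S(1) chart_openin[OF c] by auto
  moreover have "z x \<in> z ` (S \<inter> U)" using S x by auto
  moreover have "\<forall>w\<in>z ` (S \<inter> U). P (inv_into U z w)" using S(3) c by auto
  ultimately show "eventually (\<lambda>w. P (inv_into U z w)) (nhds (z x))"
    by (auto simp: eventually_nhds)
next
  assume "eventually (\<lambda>w. P (inv_into U z w)) (nhds (z x))"
  then obtain T where T: "open T" "z x \<in> T" "\<forall>w\<in>T. P (inv_into U z w)"
    by (auto simp: eventually_nhds)
  have "continuous_map (subtopology X U) euclidean z"
    using homeomorphic_imp_continuous_map[OF chart_homeo[OF c]] continuous_map_into_fulltopology by blast
  then have "openin (subtopology X U) {y \<in> topspace (subtopology X U). z y \<in> T}"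
    using T(1) by (intro openin_continuous_map_preimage) auto
  moreover have "{y \<in> topspace (subtopology X U). z y \<in> T} = {y\<in>U. z y \<in> T}"
    using openin_subset[OF chart_openin[OF c]] by auto
  ultimately have "openin X {y\<in>U. z y \<in> T}"
    using chart_openin[OF c] by (metis openin_trans_full)
  moreover have "\<forall>y\<in>{y\<in>U. z y \<in> T}. P y" using T c chart_inv by fastforce
  ultimately show "eventually P (nhdsin X x)"
    using T(2) x unfolding eventually_nhdsin by blast
qed

lemma nhdsin_chart:
  assumes "coord_chart R (U, z)" "x \<in> U"
  shows "nhdsin X x = filtermap (inv_into U z) (nhds (z x))"
  by (rule filter_eqI) (simp add: eventually_nhdsin_chart[OF assms] eventually_filtermap)

lemma eventually_atin_iff_nhdsin:
  "eventually P (atin X x) \<longleftrightarrow> eventually (\<lambda>y. y \<noteq> x \<longrightarrow> P y) (nhdsin X x)"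
  unfolding eventually_atin eventually_nhdsin by (simp add: Ball_def imp_conjL)

lemma eventually_in_open:
  "openin X S \<Longrightarrow> x \<in> S \<Longrightarrow> eventually (\<lambda>y. y \<in> S) (nhdsin X x)"
  unfolding eventually_nhdsin by blast

lemma atin_chart:
  assumes c: "coord_chart R (U, z)" and x: "x \<in> U"
  shows "atin X x = filtermap (inv_into U z) (at (z x))"
proof (rule filter_eqI)
  fix P
  have ev: "eventually (\<lambda>w. w \<in> z ` U) (nhds (z x))"
    using chart_open_range[OF c] x by (intro eventually_nhds_in_open) auto
  have "eventually P (atin X x) \<longleftrightarrow>
      eventually (\<lambda>w. inv_into U z w \<noteq> x \<longrightarrow> P (inv_into U z w)) (nhds (z x))"
    by (simp add: eventually_atin_iff_nhdsin eventually_nhdsin_chart[OF assms])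
  \<comment> \<open>The two punctures correspond only for w in the image of the chart; elsewhere
    \<open>inv_into\<close> is arbitrary.\<close>
  also have "\<dots> \<longleftrightarrow> eventually (\<lambda>w. w \<noteq> z x \<longrightarrow> P (inv_into U z w)) (nhds (z x))"
    by (intro eventually_cong eventually_mono[OF ev])
       (use c x in \<open>auto simp: f_inv_into_f\<close>)
  also have "\<dots> \<longleftrightarrow> eventually P (filtermap (inv_into U z) (at (z x)))"
    by (simp add: eventually_filtermap eventually_at_filter)
  finally show "eventually P (atin X x) \<longleftrightarrow> eventually P (filtermap (inv_into U z) (at (z x)))" .
qed

lemma atin_neq_bot:
  assumes "x \<in> points R" shows "atin X x \<noteq> bot"
proof -
  obtain U z where c: "coord_chart R (U, z)" "x \<in> U" by (rule chart_cover[OF assms])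
  show ?thesis unfolding atin_chart[OF c] filtermap_bot_iff by (rule trivial_limit_at)
qed

lemma tendsto_atin_chart:
  assumes "coord_chart R (U, z)" "x \<in> U"
  shows "(f \<longlongrightarrow> c) (atin X x) \<longleftrightarrow> ((f \<circ> inv_into U z) \<longlongrightarrow> c) (at (z x))"
  by (simp add: atin_chart[OF assms] filterlim_filtermap o_def)

text \<open>\<open>mero_val\<close> repeats the definition of \<open>remove_sings\<close> with the
  filter of the surface, so it does not depend on a chart.\<close>

lemma mero_val_chart:
  assumes "coord_chart R (U, z)" "x \<in> U"
  shows "mero_val R f x = remove_sings (f \<circ> inv_into U z) (z x)"
  unfolding mero_val_def remove_sings_def Topological_Spaces.Lim_def tendsto_atin_chart[OF assms] by (rule refl)

text \<open>By definition the two charts are compatible with the members of the atlas only, so the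
  transition map is factored through an atlas chart around x.\<close>

lemma chart_transition:
  fixes f :: "'a \<Rightarrow> complex"
  assumes c: "coord_chart R (U, z)" and d: "coord_chart R (V, w)" and x: "x \<in> U" "x \<in> V"
  shows "(w \<circ> inv_into U z) analytic_on {z x}"
    and "eventually (\<lambda>v. (f \<circ> inv_into U z) v = ((f \<circ> inv_into V w) \<circ> (w \<circ> inv_into U z)) v) (nhds (z x))"
proof -
  \<comment> \<open>Stated for arbitrary charts, because the detour through the atlas chart uses it
    again for another pair.\<close>
  have A: "eventually (\<lambda>v. (f \<circ> inv_into U z) v = ((f \<circ> inv_into V w) \<circ> (w \<circ> inv_into U z)) v) (nhds (z x))"
    if c: "coord_chart R (U, z)" and d: "coord_chart R (V, w)" and x: "x \<in> U" "x \<in> V"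
    for U V and z :: "'a \<Rightarrow> complex" and w :: "'a \<Rightarrow> complex" and f :: "'a \<Rightarrow> complex"
  proof -
    have "eventually (\<lambda>v. inv_into U z v \<in> V) (nhds (z x))"
      using eventually_in_open[OF chart_openin[OF d] x(2)]
      by (simp add: eventually_nhdsin_chart[OF c x(1)])
    then show ?thesis
      by (rule eventually_mono) (simp add: d)
  qed
  show "eventually (\<lambda>v. (f \<circ> inv_into U z) v = ((f \<circ> inv_into V w) \<circ> (w \<circ> inv_into U z)) v) (nhds (z x))"
    by (rule A[OF c d x])
  obtain W \<zeta> where W: "(W, \<zeta>) \<in> rs_atlas R" "x \<in> W"
    using atlas_cover chart_points[OF c x(1)] by metis
  have cW: "coord_chart R (W, \<zeta>)" using W atlas_coord_chart by blast
  have "(\<zeta> \<circ> inv_into U z) holomorphic_on z ` (U \<inter> W)"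
    using c W unfolding coord_chart_def chart_compatible_def by auto
  then have 1: "(\<zeta> \<circ> inv_into U z) analytic_on {z x}"
    using chart_image_open[OF c, of "U \<inter> W"] chart_openin[OF c] chart_openin[OF cW] x W
    by (auto simp: analytic_at)
  have "(w \<circ> inv_into W \<zeta>) holomorphic_on \<zeta> ` (V \<inter> W)"
    using d W unfolding coord_chart_def chart_compatible_def by auto
  then have 2: "(w \<circ> inv_into W \<zeta>) analytic_on {\<zeta> x}"
    using chart_image_open[OF cW, of "V \<inter> W"] chart_openin[OF d] chart_openin[OF cW] x W
    by (auto simp: analytic_at)
  have "((w \<circ> inv_into W \<zeta>) \<circ> (\<zeta> \<circ> inv_into U z)) analytic_on {z x}"
    using 1 2 x c by (intro analytic_on_compose) auto
  then show "(w \<circ> inv_into U z) analytic_on {z x}"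
    using analytic_at_cong[OF A[OF c cW x(1) W(2)] refl] by blast
qed

lemma hol_at_chart:
  assumes c: "coord_chart R (U, z)" and x: "x \<in> U"
  shows "hol_at f x \<longleftrightarrow> (f \<circ> inv_into U z) analytic_on {z x}"
proof
  assume "hol_at f x"
  then obtain V w where d: "coord_chart R (V, w)" "x \<in> V" "(f \<circ> inv_into V w) analytic_on {w x}"
    unfolding hol_at_def by blast
  have "((f \<circ> inv_into V w) \<circ> (w \<circ> inv_into U z)) analytic_on {z x}"
    using chart_transition(1)[OF c d(1) x d(2)] d c x by (intro analytic_on_compose) auto
  then show "(f \<circ> inv_into U z) analytic_on {z x}"
    using analytic_at_cong[OF chart_transition(2)[OF c d(1) x d(2)] refl] by blast
qed (use assms in \<open>auto simp: hol_at_def\<close>)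

lemma mer_at_chart:
  assumes c: "coord_chart R (U, z)" and x: "x \<in> U"
  shows "mer_at f x \<longleftrightarrow> (f \<circ> inv_into U z) meromorphic_on {z x}"
proof
  assume "mer_at f x"
  then obtain V w where d: "coord_chart R (V, w)" "x \<in> V" "(f \<circ> inv_into V w) meromorphic_on {w x}"
    unfolding mer_at_def by blast
  have 1: "(\<lambda>v. (f \<circ> inv_into V w) ((w \<circ> inv_into U z) v)) meromorphic_on {z x}"
    using chart_transition(1)[OF c d(1) x d(2)] d c x
    by (intro meromorphic_on_compose[OF d(3)]) (auto simp: o_def)
  have "eventually (\<lambda>v. (f \<circ> inv_into U z) v = (f \<circ> inv_into V w) ((w \<circ> inv_into U z) v)) (at (z x))"
    using eventually_nhds_conv_at[THEN iffD1, OF chart_transition(2)[OF c d(1) x d(2), of f]]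
    by (auto elim: eventually_mono)
  then have "(f \<circ> inv_into U z) meromorphic_on {z x} \<longleftrightarrow>
      (\<lambda>v. (f \<circ> inv_into V w) ((w \<circ> inv_into U z) v)) meromorphic_on {z x}"
    by (intro meromorphic_on_cong) simp_all
  with 1 show "(f \<circ> inv_into U z) meromorphic_on {z x}"
    by (rule iffD2[rotated])
qed (use assms in \<open>auto simp: mer_at_def\<close>)

text \<open>For open V the image of W \<inter> V in the plane is open, and there
  \<open>holomorphic_on\<close> is analyticity at each point.\<close>

lemma holo_on_iff:
  assumes V: "openin X V"
  shows "holo_on R V f \<longleftrightarrow> (\<forall>x\<in>V. hol_at f x)"
proof
  assume h: "holo_on R V f"
  show "\<forall>x\<in>V. hol_at f x"
  proof
    fix x assume x: "x \<in> V"
    then have "x \<in> points R" using V openin_subset by blast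
    then obtain W \<zeta> where W: "(W, \<zeta>) \<in> rs_atlas R" "x \<in> W"
      using atlas_cover by metis
    have cW: "coord_chart R (W, \<zeta>)" using W atlas_coord_chart by blast
    have "(f \<circ> inv_into W \<zeta>) holomorphic_on \<zeta> ` (W \<inter> V)"
      using h W by (auto simp: holo_on_def)
    then show "hol_at f x"
      using chart_image_open[OF cW, of "W \<inter> V"] chart_openin[OF cW] x W V
      by (auto simp: analytic_at hol_at_chart[OF cW W(2)])
  qed
next
  assume h: "\<forall>x\<in>V. hol_at f x"
  show "holo_on R V f"
    unfolding holo_on_def
  proof safe
    fix W \<zeta> assume "(W, \<zeta>) \<in> rs_atlas R"
    then have cW: "coord_chart R (W, \<zeta>)" using atlas_coord_chart by blast
    have "(f \<circ> inv_into W \<zeta>) analytic_on {\<zeta> x}" if "x \<in> W \<inter> V" for x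
      using h that hol_at_chart[OF cW] by auto
    then have "(f \<circ> inv_into W \<zeta>) analytic_on \<zeta> ` (W \<inter> V)"
      by (subst analytic_on_analytic_at) blast
    then show "(f \<circ> inv_into W \<zeta>) holomorphic_on \<zeta> ` (W \<inter> V)"
      by (rule analytic_imp_holomorphic)
  qed
qed

lemma mero_on_iff:
  assumes V: "V \<subseteq> points R"
  shows "mero_on R V f \<longleftrightarrow> (\<forall>x\<in>V. mer_at f x)"
proof
  assume h: "mero_on R V f"
  show "\<forall>x\<in>V. mer_at f x"
  proof
    fix x assume x: "x \<in> V"
    then have "x \<in> points R" using V by blast
    then obtain W \<zeta> where W: "(W, \<zeta>) \<in> rs_atlas R" "x \<in> W"
      using atlas_cover by metis
    have cW: "coord_chart R (W, \<zeta>)" using W atlas_coord_chart by blast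
    have "(f \<circ> inv_into W \<zeta>) meromorphic_on \<zeta> ` (W \<inter> V)"
      using h W by (auto simp: mero_on_def)
    then have "(f \<circ> inv_into W \<zeta>) meromorphic_on {\<zeta> x}"
      by (rule meromorphic_on_subset) (use x W in auto)
    then show "mer_at f x"
      by (simp add: mer_at_chart[OF cW W(2)])
  qed
next
  assume h: "\<forall>x\<in>V. mer_at f x"
  show "mero_on R V f"
    unfolding mero_on_def
  proof safe
    fix W \<zeta> assume "(W, \<zeta>) \<in> rs_atlas R"
    then have cW: "coord_chart R (W, \<zeta>)" using atlas_coord_chart by blast
    have "(f \<circ> inv_into W \<zeta>) meromorphic_on {\<zeta> x}" if "x \<in> W \<inter> V" for x
      using h that mer_at_chart[OF cW] by auto
    then show "(f \<circ> inv_into W \<zeta>) meromorphic_on \<zeta> ` (W \<inter> V)"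
      by (subst meromorphic_on_meromorphic_at) blast
  qed
qed

section \<open>Coordinate derivatives, and holomorphy near a meromorphic germ\<close>

lemma coord_deriv_eq: "coord_deriv (U, z) k f x = (deriv ^^ k) (f \<circ> inv_into U z) (z x)"
  by (simp add: coord_deriv_def)

lemma eventually_nhdsin_imp_atin: "eventually P (nhdsin X x) \<Longrightarrow> eventually P (atin X x)"
  unfolding eventually_atin_iff_nhdsin by (erule eventually_mono) (rule impI)

lemma eventually_nhdsin_self: "eventually P (nhdsin X x) \<Longrightarrow> x \<in> points R \<Longrightarrow> P x"
  unfolding eventually_nhdsin by blast

lemma hol_at_points: "hol_at f x \<Longrightarrow> x \<in> points R"
  unfolding hol_at_def using chart_points by blast

lemma mer_at_points: "mer_at f x \<Longrightarrow> x \<in> points R"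
  unfolding mer_at_def using chart_points by blast

lemma hol_at_cong:
  assumes "eventually (\<lambda>y. f y = g y) (nhdsin X x)" "hol_at g x"
  shows "hol_at f x"
proof -
  obtain U z where c: "coord_chart R (U, z)" "x \<in> U" "(g \<circ> inv_into U z) analytic_on {z x}"
    using assms(2) unfolding hol_at_def by blast
  have "eventually (\<lambda>w. (f \<circ> inv_into U z) w = (g \<circ> inv_into U z) w) (nhds (z x))"
    using assms(1) unfolding eventually_nhdsin_chart[OF c(1,2)] o_def .
  from analytic_at_cong[OF this refl] c(3) show ?thesis
    unfolding hol_at_chart[OF c(1,2)] by (rule iffD2)
qed

lemma mer_at_cong:
  assumes "eventually (\<lambda>y. f y = g y) (atin X x)" "mer_at g x"
  shows "mer_at f x"
proof -
  obtain U z where c: "coord_chart R (U, z)" "x \<in> U" "(g \<circ> inv_into U z) meromorphic_on {z x}"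
    using assms(2) unfolding mer_at_def by blast
  have "eventually (\<lambda>w. (f \<circ> inv_into U z) w = (g \<circ> inv_into U z) w) (at (z x))"
    using assms(1) unfolding atin_chart[OF c(1,2)] eventually_filtermap o_def .
  then have "(f \<circ> inv_into U z) meromorphic_on {z x} \<longleftrightarrow> (g \<circ> inv_into U z) meromorphic_on {z x}"
    by (intro meromorphic_on_cong) simp_all
  from this c(3) show ?thesis
    unfolding mer_at_chart[OF c(1,2)] by (rule iffD2)
qed

lemma coord_deriv_cong:
  assumes c: "coord_chart R (U, z)" "x \<in> U" and "eventually (\<lambda>y. f y = g y) (nhdsin X x)"
  shows "coord_deriv (U, z) k f x = coord_deriv (U, z) k g x"
  unfolding coord_deriv_eq
  using assms(3) unfolding eventually_nhdsin_chart[OF c]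
  by (intro higher_deriv_cong_ev) (simp_all add: o_def)

lemma coord_deriv_0 [simp]: "coord_chart R (U, z) \<Longrightarrow> x \<in> U \<Longrightarrow> coord_deriv (U, z) 0 f x = f x"
  by (simp add: coord_deriv_eq)

lemma eventually_chart_inv:
  assumes "coord_chart R (U, z)" "x \<in> U"
  shows "eventually (\<lambda>w. inv_into U z w \<in> U \<and> z (inv_into U z w) = w) (nhds (z x))"
proof -
  have "eventually (\<lambda>w. w \<in> z ` U) (nhds (z x))"
    using chart_open_range[OF assms(1)] assms(2) by (intro eventually_nhds_in_open) auto
  then show ?thesis
    by (rule eventually_mono) (auto simp: f_inv_into_f inv_into_into)
qed

text \<open>Read in its own chart, \<open>coord_deriv\<close> is the ordinary higher derivative, but
  only near z x, since \<open>inv_into\<close> is arbitrary off the image of the chart.\<close>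

lemma coord_deriv_comp_chart:
  assumes "coord_chart R (U, z)" "x \<in> U"
  shows "eventually (\<lambda>w. (coord_deriv (U, z) k f \<circ> inv_into U z) w = (deriv ^^ k) (f \<circ> inv_into U z) w)
    (nhds (z x))"
  using eventually_chart_inv[OF assms] by (rule eventually_mono) (simp add: coord_deriv_eq)

lemma coord_deriv_Suc:
  assumes "coord_chart R (U, z)" "x \<in> U"
  shows "coord_deriv (U, z) (Suc k) f x = coord_deriv (U, z) 1 (coord_deriv (U, z) k f) x"
proof -
  have "coord_deriv (U, z) 1 (coord_deriv (U, z) k f) x = deriv (coord_deriv (U, z) k f \<circ> inv_into U z) (z x)"
    unfolding coord_deriv_eq[of U z 1] by simp
  also have "\<dots> = deriv ((deriv ^^ k) (f \<circ> inv_into U z)) (z x)"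
    by (rule deriv_cong_ev[OF coord_deriv_comp_chart[OF assms, of k f] refl])
  finally show ?thesis
    unfolding coord_deriv_eq by simp
qed

lemma hol_at_coord_deriv:
  assumes c: "coord_chart R (U, z)" "x \<in> U" and f: "hol_at f x"
  shows "hol_at (coord_deriv (U, z) k f) x"
proof -
  have "(deriv ^^ k) (f \<circ> inv_into U z) analytic_on {z x}"
    using f unfolding hol_at_chart[OF c] by (induction k) (auto intro: analytic_deriv)
  then show ?thesis
    unfolding hol_at_chart[OF c] using analytic_at_cong[OF coord_deriv_comp_chart[OF c] refl] by blast
qed

lemma mer_at_coord_deriv:
  assumes c: "coord_chart R (U, z)" "x \<in> U" and f: "mer_at f x"
  shows "mer_at (coord_deriv (U, z) k f) x"
proof -
  have 1: "(deriv ^^ k) (f \<circ> inv_into U z) meromorphic_on {z x}"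
    using f unfolding mer_at_chart[OF c] by (rule meromorphic_on_higher_deriv)
  have "eventually (\<lambda>w. (coord_deriv (U, z) k f \<circ> inv_into U z) w = (deriv ^^ k) (f \<circ> inv_into U z) w)
      (at (z x))"
    using coord_deriv_comp_chart[OF c, of k f] eventually_nhds_conv_at by blast
  then have "(coord_deriv (U, z) k f \<circ> inv_into U z) meromorphic_on {z x} \<longleftrightarrow>
      (deriv ^^ k) (f \<circ> inv_into U z) meromorphic_on {z x}"
    by (intro meromorphic_on_cong) simp_all
  from this 1 show ?thesis
    unfolding mer_at_chart[OF c] by (rule iffD2)
qed

text \<open>Singularities are isolated, so finitely many meromorphic functions are simultaneously
  holomorphic throughout a punctured neighbourhood.\<close>

lemma mer_at_hol_nearby:
  assumes "mer_at f x" shows "eventually (hol_at f) (atin X x)"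
proof -
  obtain U z where c: "coord_chart R (U, z)" "x \<in> U" "(f \<circ> inv_into U z) meromorphic_on {z x}"
    using assms unfolding mer_at_def by blast
  have "eventually (\<lambda>w. (f \<circ> inv_into U z) analytic_on {w}) (at (z x))"
    using c(3) meromorphic_on_isolated_singularity isolated_singularity_at_altdef by blast
  moreover have "eventually (\<lambda>w. inv_into U z w \<in> U \<and> z (inv_into U z w) = w) (at (z x))"
    using eventually_chart_inv[OF c(1,2)] eventually_nhds_conv_at by blast
  ultimately show ?thesis
    unfolding atin_chart[OF c(1,2)] eventually_filtermap
  proof eventually_elim
    case (elim w)
    then have "(f \<circ> inv_into U z) analytic_on {z (inv_into U z w)}" by simp
    then show ?case using elim hol_at_chart[OF c(1)] by blast
  qed
qed

section \<open>Values at a point: continuity, canonical representatives, local identity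
  principle\<close>

lemma hol_at_imp_mer_at: "hol_at f x \<Longrightarrow> mer_at f x"
  unfolding hol_at_def mer_at_def using analytic_on_imp_meromorphic_on by blast

lemma hol_at_tendsto_nhdsin:
  assumes "hol_at f x" shows "(f \<longlongrightarrow> f x) (nhdsin X x)"
proof -
  obtain U z where c: "coord_chart R (U, z)" "x \<in> U" "(f \<circ> inv_into U z) analytic_on {z x}"
    using assms unfolding hol_at_def by blast
  have "((f \<circ> inv_into U z) \<longlongrightarrow> (f \<circ> inv_into U z) (z x)) (nhds (z x))"
    using analytic_at_imp_isCont[OF c(3)] by (simp only: continuous_at tendsto_at_iff_tendsto_nhds)
  then show ?thesis
    unfolding nhdsin_chart[OF c(1,2)] filterlim_filtermap using c by (simp add: o_def)
qed

lemma hol_at_tendsto: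
  assumes "hol_at f x" shows "(f \<longlongrightarrow> f x) (atin X x)"
  using hol_at_tendsto_nhdsin[OF assms] unfolding atin_def by (rule tendsto_mono[OF inf_le1])

lemma hol_at_nonzero_nhds:
  assumes "hol_at f x" "f x \<noteq> 0" shows "eventually (\<lambda>y. f y \<noteq> 0) (nhdsin X x)"
  using tendsto_imp_eventually_ne[OF hol_at_tendsto_nhdsin[OF assms(1)] assms(2)] .

lemma mero_val_tendsto:
  assumes "(f \<longlongrightarrow> c) (atin X x)" "x \<in> points R"
  shows "mero_val R f x = c"
  using assms tendsto_Lim[OF atin_neq_bot[OF assms(2)] assms(1)] by (auto simp: mero_val_def)

lemma mero_val_hol: "hol_at f x \<Longrightarrow> mero_val R f x = f x"
  by (rule mero_val_tendsto[OF hol_at_tendsto hol_at_points])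

lemma mero_val_cong:
  assumes "eventually (\<lambda>y. f y = g y) (atin X x)"
  shows "mero_val R f x = mero_val R g x"
proof -
  have "(f \<longlongrightarrow> c) (atin X x) \<longleftrightarrow> (g \<longlongrightarrow> c) (atin X x)" for c
    by (rule tendsto_cong[OF assms])
  then show ?thesis
    unfolding mero_val_def Topological_Spaces.Lim_def by simp
qed

lemma mero_val_eq_nearby:
  "mer_at f x \<Longrightarrow> eventually (\<lambda>y. mero_val R f y = f y) (atin X x)"
  using eventually_mono[OF mer_at_hol_nearby mero_val_hol] .

lemma mer_at_mero_val: "mer_at f x \<Longrightarrow> mer_at (mero_val R f) x"
  by (rule mer_at_cong[OF mero_val_eq_nearby])

text \<open>Riemann's theorem on removable singularities, through \<open>remove_sings\<close> in a
  chart.\<close>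

lemma hol_at_mero_val:
  assumes f: "mer_at f x" and l: "(f \<longlongrightarrow> l) (atin X x)"
  shows "hol_at (mero_val R f) x"
proof -
  obtain U z where c: "coord_chart R (U, z)" "x \<in> U" "(f \<circ> inv_into U z) meromorphic_on {z x}"
    using f unfolding mer_at_def by blast
  have "remove_sings (f \<circ> inv_into U z) analytic_on {z x}"
    using remove_sings_analytic_at meromorphic_on_isolated_singularity[OF c(3)]
      l[unfolded tendsto_atin_chart[OF c(1,2)]] by blast
  moreover have "eventually (\<lambda>w. (mero_val R f \<circ> inv_into U z) w = remove_sings (f \<circ> inv_into U z) w)
      (nhds (z x))"
    using eventually_chart_inv[OF c(1,2)]
    by (rule eventually_mono) (simp add: mero_val_chart[OF c(1)])
  ultimately show ?thesis
    unfolding hol_at_chart[OF c(1,2)] using analytic_at_cong[OF _ refl] by blast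
qed

text \<open>Zeros of a meromorphic function that is not locally zero are isolated. This alternative
  later splits the surface into two open sets.\<close>

lemma mer_at_dichotomy:
  assumes "mer_at f x"
  shows "eventually (\<lambda>y. f y = 0) (atin X x) \<or> eventually (\<lambda>y. f y \<noteq> 0) (atin X x)"
proof -
  obtain U z where c: "coord_chart R (U, z)" "x \<in> U" "(f \<circ> inv_into U z) meromorphic_on {z x}"
    using assms unfolding mer_at_def by blast
  show ?thesis
    using not_essential_frequently_0_imp_eventually_0[OF meromorphic_on_isolated_singularity[OF c(3)]
        meromorphic_on_not_essential[OF c(3)]]
    unfolding atin_chart[OF c(1,2)] eventually_filtermap frequently_def o_def by blast
qed

section \<open>Closure rules for holomorphic and meromorphic germs\<close>

lemma hol_at_const [intro]: "x \<in> points R \<Longrightarrow> hol_at (\<lambda>_. k) x"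
  unfolding hol_at_def by (rule chart_cover[of x]) (auto simp: o_def)

lemma hol_at_chart_fun: "coord_chart R (U, z) \<Longrightarrow> x \<in> U \<Longrightarrow> hol_at z x"
  using chart_transition(1)[of U z U z] by (auto simp: hol_at_def)

lemma hol_at_add [intro]:
  assumes f: "hol_at f x" and g: "hol_at g x"
  shows "hol_at (\<lambda>y. f y + g y) x"
proof -
  obtain U z where c: "coord_chart R (U, z)" "x \<in> U"
    using f unfolding hol_at_def by blast
  show ?thesis
    using f g unfolding hol_at_chart[OF c] o_def by (rule analytic_on_add)
qed

lemma hol_at_mult [intro]:
  assumes f: "hol_at f x" and g: "hol_at g x"
  shows "hol_at (\<lambda>y. f y * g y) x"
proof -
  obtain U z where c: "coord_chart R (U, z)" "x \<in> U"
    using f unfolding hol_at_def by blast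
  show ?thesis
    using f g unfolding hol_at_chart[OF c] o_def by (rule analytic_on_mult)
qed

lemma hol_at_divide [intro]:
  assumes f: "hol_at f x" and g: "hol_at g x" and 0: "g x \<noteq> 0"
  shows "hol_at (\<lambda>y. f y / g y) x"
proof -
  obtain U z where c: "coord_chart R (U, z)" "x \<in> U"
    using f unfolding hol_at_def by blast
  show ?thesis
    using f g unfolding hol_at_chart[OF c] o_def using 0 c by (intro analytic_on_divide) auto
qed

lemma hol_at_sum [intro]:
  "x \<in> points R \<Longrightarrow> (\<And>i. i \<in> J \<Longrightarrow> hol_at (f i) x) \<Longrightarrow> hol_at (\<lambda>y. \<Sum>i\<in>J. f i y) x"
  by (induction J rule: infinite_finite_induct) auto

lemma hol_at_prod [intro]:
  "x \<in> points R \<Longrightarrow> (\<And>i. i \<in> J \<Longrightarrow> hol_at (f i) x) \<Longrightarrow> hol_at (\<lambda>y. \<Prod>i\<in>J. f i y) x"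
  by (induction J rule: infinite_finite_induct) auto

lemma hol_at_power [intro]: "hol_at f x \<Longrightarrow> hol_at (\<lambda>y. f y ^ k) x"
  by (induction k) (auto dest: hol_at_points)

lemma mer_at_const [intro]: "x \<in> points R \<Longrightarrow> mer_at (\<lambda>_. k) x"
  by (rule hol_at_imp_mer_at[OF hol_at_const])

lemma mer_at_add [intro]:
  assumes f: "mer_at f x" and g: "mer_at g x"
  shows "mer_at (\<lambda>y. f y + g y) x"
proof -
  obtain U z where c: "coord_chart R (U, z)" "x \<in> U"
    using f unfolding mer_at_def by blast
  show ?thesis
    using f g unfolding mer_at_chart[OF c] o_def by (rule meromorphic_on_add)
qed

lemma mer_at_mult [intro]:
  assumes f: "mer_at f x" and g: "mer_at g x"
  shows "mer_at (\<lambda>y. f y * g y) x"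
proof -
  obtain U z where c: "coord_chart R (U, z)" "x \<in> U"
    using f unfolding mer_at_def by blast
  show ?thesis
    using f g unfolding mer_at_chart[OF c] o_def by (rule meromorphic_on_mult)
qed

lemma mer_at_divide [intro]:
  assumes f: "mer_at f x" and g: "mer_at g x"
  shows "mer_at (\<lambda>y. f y / g y) x"
proof -
  obtain U z where c: "coord_chart R (U, z)" "x \<in> U"
    using f unfolding mer_at_def by blast
  show ?thesis
    using f g unfolding mer_at_chart[OF c] o_def by (rule meromorphic_on_divide)
qed

lemma mer_at_sum [intro]:
  "x \<in> points R \<Longrightarrow> (\<And>i. i \<in> J \<Longrightarrow> mer_at (f i) x) \<Longrightarrow> mer_at (\<lambda>y. \<Sum>i\<in>J. f i y) x"
  by (induction J rule: infinite_finite_induct) auto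

lemma mer_at_prod [intro]:
  "x \<in> points R \<Longrightarrow> (\<And>i. i \<in> J \<Longrightarrow> mer_at (f i) x) \<Longrightarrow> mer_at (\<lambda>y. \<Prod>i\<in>J. f i y) x"
  by (induction J rule: infinite_finite_induct) auto

section \<open>First-order rules: sums, products, change of coordinate\<close>

lemma has_coord_deriv:
  assumes c: "coord_chart R (U, z)" "x \<in> U" and f: "hol_at f x"
  shows "((\<lambda>w. f (inv_into U z w)) has_field_derivative coord_deriv (U, z) 1 f x) (at (z x))"
  using analytic_derivI f unfolding hol_at_chart[OF c] coord_deriv_eq by (force simp: o_def)

lemma coord_deriv_eqI:
  assumes "((\<lambda>w. f (inv_into U z w)) has_field_derivative d) (at (z x))"
  shows "coord_deriv (U, z) 1 f x = d"
  using DERIV_imp_deriv[OF assms] by (simp add: coord_deriv_eq o_def)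

lemma coord_deriv_const [simp]: "coord_deriv (U, z) (Suc 0) (\<lambda>_. k) x = 0"
  using coord_deriv_eqI[of "\<lambda>_. k" U z 0 x] by simp

lemma coord_deriv_sum:
  assumes c: "coord_chart R (U, z)" "x \<in> U" and f: "\<And>i. i \<in> J \<Longrightarrow> hol_at (f i) x"
  shows "coord_deriv (U, z) 1 (\<lambda>y. \<Sum>i\<in>J. f i y) x = (\<Sum>i\<in>J. coord_deriv (U, z) 1 (f i) x)"
  by (intro coord_deriv_eqI DERIV_sum has_coord_deriv assms)

lemma coord_deriv_mult:
  assumes c: "coord_chart R (U, z)" "x \<in> U" and f: "hol_at f x" and g: "hol_at g x"
  shows "coord_deriv (U, z) 1 (\<lambda>y. f y * g y) x =
    coord_deriv (U, z) 1 f x * g x + f x * coord_deriv (U, z) 1 g x"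
  using coord_deriv_eqI[OF DERIV_mult'[OF has_coord_deriv[OF c f] has_coord_deriv[OF c g]]] c
  by (simp add: algebra_simps)

lemma coord_deriv_prod:
  assumes c: "coord_chart R (U, z)" "x \<in> U" and f: "\<And>i. i \<in> J \<Longrightarrow> hol_at (f i) x"
  shows "coord_deriv (U, z) 1 (\<lambda>y. \<Prod>i\<in>J. f i y) x =
    (\<Sum>i\<in>J. coord_deriv (U, z) 1 (f i) x * (\<Prod>j\<in>J - {i}. f j x))"
  using f
proof (induction J rule: infinite_finite_induct)
  case (insert a J)
  have "coord_deriv (U, z) 1 (\<lambda>y. \<Prod>i\<in>insert a J. f i y) x =
      coord_deriv (U, z) 1 (f a) x * (\<Prod>i\<in>J. f i x) +
      f a x * (\<Sum>i\<in>J. coord_deriv (U, z) 1 (f i) x * (\<Prod>j\<in>J - {i}. f j x))"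
    using insert chart_points[OF c]
    by (simp add: coord_deriv_mult[OF c] hol_at_prod del: One_nat_def)
  also have "f a x * (\<Sum>i\<in>J. coord_deriv (U, z) 1 (f i) x * (\<Prod>j\<in>J - {i}. f j x)) =
      (\<Sum>i\<in>J. coord_deriv (U, z) 1 (f i) x * (\<Prod>j\<in>insert a J - {i}. f j x))"
    unfolding sum_distrib_left
  proof (rule sum.cong)
    fix i assume "i \<in> J"
    then have "insert a J - {i} = insert a (J - {i})" "a \<notin> J - {i}" using insert by auto
    then show "f a x * (coord_deriv (U, z) 1 (f i) x * (\<Prod>j\<in>J - {i}. f j x)) =
        coord_deriv (U, z) 1 (f i) x * (\<Prod>j\<in>insert a J - {i}. f j x)"
      using insert by simp
  qed simp
  also have "(\<Prod>i\<in>J. f i x) = (\<Prod>j\<in>insert a J - {a}. f j x)"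
    using insert by simp
  finally show ?case
    using insert by simp
qed simp_all

text \<open>The transition map is \<open>w\<close> read in the coordinate \<open>z\<close>, so its
  derivative is itself a \<open>coord_deriv\<close>; the rest is the chain rule in the
  plane.\<close>

lemma coord_deriv_chain:
  assumes c: "coord_chart R (U, z)" "x \<in> U" and d: "coord_chart R (V, w)" "x \<in> V" and f: "hol_at f x"
  shows "coord_deriv (U, z) 1 f x = coord_deriv (V, w) 1 f x * coord_deriv (U, z) 1 w x"
proof -
  let ?g = "w \<circ> inv_into U z" and ?f = "f \<circ> inv_into V w"
  have 1: "(?f has_field_derivative coord_deriv (V, w) 1 f x) (at (?g (z x)))"
    using has_coord_deriv[OF d f] c by (simp add: o_def)
  have 2: "(?g has_field_derivative coord_deriv (U, z) 1 w x) (at (z x))"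
    using has_coord_deriv[OF c hol_at_chart_fun[OF d]] by (simp add: o_def)
  have "coord_deriv (U, z) 1 f x = deriv (?f \<circ> ?g) (z x)"
    using deriv_cong_ev[OF chart_transition(2)[OF c(1) d(1) c(2) d(2), of f] refl]
    by (simp add: coord_deriv_eq o_def)
  also have "\<dots> = coord_deriv (V, w) 1 f x * coord_deriv (U, z) 1 w x"
    by (intro DERIV_imp_deriv DERIV_chain 1 2)
  finally show ?thesis .
qed

lemma coord_deriv_self:
  assumes c: "coord_chart R (U, z)" "x \<in> U"
  shows "coord_deriv (U, z) 1 z x = 1"
proof -
  have "eventually (\<lambda>w. (z \<circ> inv_into U z) w = w) (nhds (z x))"
    using eventually_chart_inv[OF c] by (rule eventually_mono) simp
  then have "deriv (z \<circ> inv_into U z) (z x) = deriv (\<lambda>w. w) (z x)"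
    by (rule deriv_cong_ev) simp
  then show ?thesis by (simp add: coord_deriv_eq)
qed

text \<open>The chain rule applied to \<open>z\<close> itself writes 1 as a product with this
  factor.\<close>

lemma coord_deriv_chart_nonzero:
  assumes c: "coord_chart R (U, z)" "x \<in> U" and d: "coord_chart R (V, w)" "x \<in> V"
  shows "coord_deriv (U, z) 1 w x \<noteq> 0"
  using coord_deriv_chain[OF c d hol_at_chart_fun[OF c]] unfolding coord_deriv_self[OF c] by auto

text \<open>Points are closed because the surface is Hausdorff, so the punctured neighbourhood is
  open and contains a neighbourhood of each of its points.\<close>

lemma punctured_nhd:
  assumes "eventually P (atin X x)" "x \<in> points R"
  obtains N where "openin X N" "x \<in> N" "openin X (N - {x})" "\<And>y. y \<in> N - {x} \<Longrightarrow> P y"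
proof -
  obtain N where N: "openin X N" "x \<in> N" "\<forall>y\<in>N - {x}. P y"
    using assms unfolding eventually_atin by blast
  have "closedin X {x}"
    using riemann assms(2) by (simp add: riemann_surface_def closedin_Hausdorff_singleton)
  then have "openin X (N - {x})"
    using N(1) by (rule openin_diff[rotated])
  with N that show thesis by blast
qed

text \<open>Allows an identity known only off x to be differentiated at the nearby points, where it
  holds in a full neighbourhood.\<close>

lemma eventually_atin_nhdsin:
  assumes "eventually P (atin X x)" "x \<in> points R"
  shows "eventually (\<lambda>y. eventually P (nhdsin X y)) (atin X x)"
proof -
  obtain N where N: "openin X N" "x \<in> N" "openin X (N - {x})" "\<And>y. y \<in> N - {x} \<Longrightarrow> P y"
    by (rule punctured_nhd[OF assms]) blast
  have "eventually P (nhdsin X y)" if "y \<in> N - {x}" for y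
    using eventually_mono[OF eventually_in_open[OF N(3) that] N(4)] .
  then show ?thesis
    unfolding eventually_atin using N by blast
qed

section \<open>Orders of vanishing\<close>

lemma ord_at_chart:
  assumes "x \<in> points R"
  obtains U z where "coord_chart R (U, z)" "x \<in> U" "\<And>f. ord_at R f x = zorder (f \<circ> inv_into U z) (z x)"
proof -
  \<comment> \<open>The chart chosen in \<open>ord_at\<close> depends on x only, so a single chart
    serves for all f and orders can be compared inside it.\<close>
  obtain U z where Uz: "(SOME c. coord_chart R c \<and> x \<in> fst c) = (U, z)" by (metis surj_pair)
  have "\<exists>c. coord_chart R c \<and> x \<in> fst c"
    using chart_cover[OF assms] by (metis fst_conv)
  then have "coord_chart R (U, z) \<and> x \<in> fst (U, z)"
    using someI_ex[of "\<lambda>c. coord_chart R c \<and> x \<in> fst c"] unfolding Uz by blast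
  then show thesis using that[of U z] by (simp add: ord_at_def Uz)
qed

text \<open>Orders add under products, and a unit has order 0. The order is read off x, so an
  identity in a punctured neighbourhood suffices.\<close>

lemma ord_at_mult_unit:
  assumes g: "mer_at g x" "eventually (\<lambda>y. g y \<noteq> 0) (atin X x)"
    and h: "hol_at h x" "h x \<noteq> 0" and f: "eventually (\<lambda>y. f y = h y * g y) (atin X x)"
  shows "ord_at R f x = ord_at R g x"
proof -
  obtain U z where c: "coord_chart R (U, z)" "x \<in> U"
    and o: "\<And>f. ord_at R f x = zorder (f \<circ> inv_into U z) (z x)"
    using ord_at_chart[OF mer_at_points[OF g(1)]] by metis
  let ?g = "g \<circ> inv_into U z" and ?h = "h \<circ> inv_into U z" and ?f = "f \<circ> inv_into U z"
  have gm: "?g meromorphic_on {z x}" using g(1) mer_at_chart[OF c] by blast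
  have ha: "?h analytic_on {z x}" using h(1) hol_at_chart[OF c] by blast
  have "eventually (\<lambda>w. ?f w = ?g w * ?h w) (at (z x))"
    using f unfolding atin_chart[OF c] eventually_filtermap by (simp add: mult.commute)
  then have "zorder ?f (z x) = zorder (\<lambda>w. ?g w * ?h w) (z x)"
    by (rule zorder_cong) simp
  also have "\<dots> = zorder ?g (z x) + zorder ?h (z x)"
  proof (rule zorder_times_analytic'[OF meromorphic_on_isolated_singularity[OF gm]
        meromorphic_on_not_essential[OF gm] ha])
    have "eventually (\<lambda>y. g y * h y \<noteq> 0) (atin X x)"
      using g(2) eventually_nhdsin_imp_atin[OF hol_at_nonzero_nhds[OF h]] by eventually_elim simp
    then have "eventually (\<lambda>w. ?g w * ?h w \<noteq> 0) (at (z x))"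
      unfolding atin_chart[OF c] eventually_filtermap by simp
    then show "frequently (\<lambda>w. ?g w * ?h w \<noteq> 0) (at (z x))"
      by (rule eventually_frequently[rotated]) simp
  qed
  also have "zorder ?h (z x) = 0"
    using h(2) c by (intro zorder_eq_0I[OF ha]) simp
  finally show ?thesis by (simp add: o o_def)
qed

text \<open>Both functions are a unit times the same power of w - z x, and the power cancels in the
  quotient.\<close>

lemma ord_at_eq_ratio:
  assumes f: "mer_at f x" "eventually (\<lambda>y. f y \<noteq> 0) (atin X x)"
    and g: "mer_at g x" "eventually (\<lambda>y. g y \<noteq> 0) (atin X x)"
    and o: "ord_at R f x = ord_at R g x"
  obtains l where "l \<noteq> 0" "((\<lambda>y. f y / g y) \<longlongrightarrow> l) (atin X x)"
proof -
  obtain U z where c: "coord_chart R (U, z)" "x \<in> U"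
    and oc: "\<And>f. ord_at R f x = zorder (f \<circ> inv_into U z) (z x)"
    using ord_at_chart[OF mer_at_points[OF g(1)]] by metis
  have *: "\<exists>p. isCont p (z x) \<and> p (z x) \<noteq> 0 \<and> eventually (\<lambda>w. (f \<circ> inv_into U z) w =
      p w * (w - z x) powi ord_at R f x) (at (z x))"
    if f: "mer_at f x" "eventually (\<lambda>y. f y \<noteq> 0) (atin X x)" for f
  proof -
    let ?f = "f \<circ> inv_into U z"
    have fm: "?f meromorphic_on {z x}" using f(1) mer_at_chart[OF c] by blast
    have "eventually (\<lambda>w. ?f w \<noteq> 0) (at (z x))"
      using f(2) unfolding atin_chart[OF c] eventually_filtermap by simp
    then have fr: "frequently (\<lambda>w. ?f w \<noteq> 0) (at (z x))"
      by (rule eventually_frequently[rotated]) simp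
    obtain r where r: "zor_poly ?f (z x) (z x) \<noteq> 0" "r > 0"
      "zor_poly ?f (z x) holomorphic_on cball (z x) r"
      "\<forall>w\<in>cball (z x) r - {z x}. ?f w = zor_poly ?f (z x) w * (w - z x) powi zorder ?f (z x)"
      using zorder_exist[OF meromorphic_on_isolated_singularity[OF fm]
          meromorphic_on_not_essential[OF fm] fr] by blast
    have "isCont (zor_poly ?f (z x)) (z x)"
      using r by (intro continuous_on_interior[OF holomorphic_on_imp_continuous_on[OF r(3)]]) auto
    moreover have "eventually (\<lambda>w. w \<in> cball (z x) r - {z x}) (at (z x))"
      using r(2) by (auto simp: eventually_at dist_commute intro!: exI[of _ r])
    then have "eventually (\<lambda>w. ?f w = zor_poly ?f (z x) w * (w - z x) powi ord_at R f x) (at (z x))"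
      unfolding oc by (rule eventually_mono) (use r(4) in blast)
    ultimately show ?thesis using r(1) by blast
  qed
  obtain p where p: "isCont p (z x)" "p (z x) \<noteq> 0" "eventually (\<lambda>w. (f \<circ> inv_into U z) w =
      p w * (w - z x) powi ord_at R f x) (at (z x))"
    using *[OF f] by blast
  obtain q where q: "isCont q (z x)" "q (z x) \<noteq> 0" "eventually (\<lambda>w. (g \<circ> inv_into U z) w =
      q w * (w - z x) powi ord_at R f x) (at (z x))"
    using *[OF g] o by auto
  have "((\<lambda>w. p w / q w) \<longlongrightarrow> p (z x) / q (z x)) (at (z x))"
    using p(1,2) q(1,2) by (intro tendsto_divide) (simp_all add: isContD)
  \<comment> \<open>Away from z x the power is non-zero, also for a negative exponent, and can be
    cancelled.\<close>
  moreover have "eventually (\<lambda>w. p w / q w = ((\<lambda>y. f y / g y) \<circ> inv_into U z) w) (at (z x))"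
    using p(3) q(3) eventually_neq_at_within[of "z x" "z x" UNIV]
    by eventually_elim (simp add: power_int_eq_0_iff)
  ultimately have "((\<lambda>y. f y / g y) \<longlongrightarrow> p (z x) / q (z x)) (atin X x)"
    unfolding tendsto_atin_chart[OF c] by (rule Lim_transform_eventually)
  moreover have "p (z x) / q (z x) \<noteq> 0" using p q by simp
  ultimately show thesis using that by blast
qed

lemma ord_at_const:
  assumes "x \<in> points R" "k \<noteq> 0" shows "ord_at R (\<lambda>_. k) x = 0"
proof -
  obtain U z where "\<And>f. ord_at R f x = zorder (f \<circ> inv_into U z) (z x)"
    using ord_at_chart[OF assms(1)] by metis
  then show ?thesis using assms(2) by (simp add: o_def zorder_eq_0I)
qed

text \<open>Order 0 is the order of the constant 1, so the quotient of f by 1 has a non-zero limit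
  and the singularity is removable.\<close>

lemma hol_at_mero_val_ord_0:
  assumes f: "mer_at f x" "eventually (\<lambda>y. f y \<noteq> 0) (atin X x)" "ord_at R f x = 0"
  shows "hol_at (mero_val R f) x" "mero_val R f x \<noteq> 0"
proof -
  have pt: "x \<in> points R" using mer_at_points[OF f(1)] .
  obtain l where l: "l \<noteq> 0" "((\<lambda>y. f y / 1) \<longlongrightarrow> l) (atin X x)"
    using ord_at_eq_ratio[OF f(1,2) mer_at_const[OF pt, of 1]] ord_at_const[OF pt, of 1] f(3) by auto
  then have "(f \<longlongrightarrow> l) (atin X x)" by simp
  then show "hol_at (mero_val R f) x" "mero_val R f x \<noteq> 0"
    using hol_at_mero_val[OF f(1)] mero_val_tendsto[OF _ pt] l(1) by blast+
qed

section \<open>Change of coordinate and trivialization; derivative of the Wronskian\<close>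

text \<open>One differentiation raises the order of the derivatives that occur by at most one. This
  is the triangular shape of the change matrix.\<close>

lemma leibniz_coeff_zero: "k < j \<Longrightarrow> leibniz_coeff (U, z) w \<mu> k j = (\<lambda>_. 0)"
proof (induction k arbitrary: j)
  case (Suc k)
  have "leibniz_coeff (U, z) w \<mu> k j = (\<lambda>_. 0)" "leibniz_coeff (U, z) w \<mu> k (j - 1) = (\<lambda>_. 0)"
    using Suc by auto
  then show ?case by (simp only: leibniz_coeff.simps) (simp add: fun_eq_iff)
qed simp

text \<open>On the diagonal the derivative term of the recursion vanishes by
  \<open>leibniz_coeff_zero\<close>, and the shift term adds one factor dw/dz per step.\<close>

lemma leibniz_coeff_diag:
  "leibniz_coeff (U, z) w \<mu> k k y = \<mu> y * coord_deriv (U, z) 1 w y ^ k"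
proof (induction k)
  case (Suc k)
  have "leibniz_coeff (U, z) w \<mu> k (Suc k) = (\<lambda>_. 0)"
    by (rule leibniz_coeff_zero) simp
  with Suc show ?case by simp
qed simp

lemma hol_at_leibniz_coeff:
  assumes c: "coord_chart R (U, z)" "x \<in> U" and d: "coord_chart R (V, w)" "x \<in> V" and \<mu>: "hol_at \<mu> x"
  shows "hol_at (leibniz_coeff (U, z) w \<mu> k j) x"
proof (induction k arbitrary: j)
  case 0
  show ?case using \<mu> chart_points[OF c] by (cases "j = 0") auto
next
  case (Suc k)
  have 1: "hol_at (coord_deriv (U, z) 1 (leibniz_coeff (U, z) w \<mu> k j)) x"
    by (rule hol_at_coord_deriv[OF c Suc])
  have 2: "hol_at (\<lambda>y. leibniz_coeff (U, z) w \<mu> k (j - 1) y * coord_deriv (U, z) 1 w y) x"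
    by (intro hol_at_mult Suc hol_at_coord_deriv[OF c] hol_at_chart_fun[OF d])
  show ?case
    using 1 hol_at_add[OF 1 2] by (cases "j = 0") (simp_all del: One_nat_def)
qed

text \<open>Higher product and chain rule for \<open>\<mu>\<close> times a linear combination. Being
  constant, the \<open>t r\<close> stay outside all derivatives, and \<open>leibniz_coeff\<close>
  sees neither \<open>a\<close> nor \<open>t\<close>. The relation is assumed on an open S because
  the induction differentiates it.\<close>

lemma coord_deriv_change:
  assumes c: "coord_chart R (U, z)" and d: "coord_chart R (V, w)"
    and S: "openin X S" "S \<subseteq> U \<inter> V"
    and \<mu>: "\<And>y. y \<in> S \<Longrightarrow> hol_at \<mu> y"
    and a: "\<And>r y. r < n \<Longrightarrow> y \<in> S \<Longrightarrow> hol_at (a r) y"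
    and f: "\<And>y. y \<in> S \<Longrightarrow> f y = \<mu> y * (\<Sum>r<n. t r * a r y)"
    and x: "x \<in> S"
  shows "coord_deriv (U, z) k f x =
    (\<Sum>j\<le>k. leibniz_coeff (U, z) w \<mu> k j x * (\<Sum>r<n. t r * coord_deriv (V, w) j (a r) x))"
  using x
proof (induction k arbitrary: x)
  case 0
  then have "x \<in> U" "x \<in> V" using S by auto
  with 0 show ?case using f c d by simp
next
  case (Suc k)
  then have cx: "coord_chart R (U, z)" "x \<in> U" and dx: "coord_chart R (V, w)" "x \<in> V"
    using c d S by auto
  have pt: "x \<in> points R" using chart_points[OF cx] .
  define b where "b j y = (\<Sum>r<n. t r * coord_deriv (V, w) j (a r) y)" for j y
  let ?L = "leibniz_coeff (U, z) w \<mu> k"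
  have hL: "hol_at (?L j) x" for j
    using hol_at_leibniz_coeff[OF cx dx] \<mu> Suc.prems by blast
  have hb: "hol_at (b j) x" for j
    unfolding b_def using a Suc.prems hol_at_coord_deriv[OF dx] pt
    by (intro hol_at_sum hol_at_mult hol_at_const) auto
  \<comment> \<open>In the coordinate \<open>w\<close>, differentiation shifts \<open>b j\<close> to
    \<open>b (Suc j)\<close>; passing to \<open>z\<close> costs the factor dw/dz.\<close>
  have Db: "coord_deriv (U, z) 1 (b j) x = b (Suc j) x * coord_deriv (U, z) 1 w x" for j
  proof -
    have "coord_deriv (V, w) 1 (b j) x =
        (\<Sum>r<n. coord_deriv (V, w) 1 (\<lambda>y. t r * coord_deriv (V, w) j (a r) y) x)"
      unfolding b_def using a Suc.prems hol_at_coord_deriv[OF dx] pt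
      by (intro coord_deriv_sum[OF dx] hol_at_mult hol_at_const) auto
    also have "\<dots> = b (Suc j) x"
      unfolding b_def
    proof (rule sum.cong)
      fix r assume "r \<in> {..<n}"
      then have "hol_at (coord_deriv (V, w) j (a r)) x"
        using a Suc.prems hol_at_coord_deriv[OF dx] by auto
      then show "coord_deriv (V, w) 1 (\<lambda>y. t r * coord_deriv (V, w) j (a r) y) x =
          t r * coord_deriv (V, w) (Suc j) (a r) x"
        using coord_deriv_mult[OF dx hol_at_const[OF pt, of "t r"], of "coord_deriv (V, w) j (a r)"]
        unfolding coord_deriv_Suc[OF dx, of j "a r"] by simp
    qed simp
    finally show ?thesis
      using coord_deriv_chain[OF cx dx hb] by simp
  qed
  \<comment> \<open>The induction hypothesis holds at all points of the open set S, hence as an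
    identity near x.\<close>
  have "eventually (\<lambda>y. coord_deriv (U, z) k f y = (\<Sum>j\<le>k. ?L j y * b j y)) (nhdsin X x)"
    using eventually_in_open[OF S(1) Suc.prems]
    by (rule eventually_mono) (simp add: Suc.IH b_def)
  then have "coord_deriv (U, z) (Suc k) f x = coord_deriv (U, z) 1 (\<lambda>y. \<Sum>j\<le>k. ?L j y * b j y) x"
    unfolding coord_deriv_Suc[OF cx, of k f] by (rule coord_deriv_cong[OF cx])
  also have "\<dots> = (\<Sum>j\<le>k. coord_deriv (U, z) 1 (\<lambda>y. ?L j y * b j y) x)"
    by (intro coord_deriv_sum[OF cx] hol_at_mult hL hb)
  also have "\<dots> = (\<Sum>j\<le>k. coord_deriv (U, z) 1 (?L j) x * b j x) +
      (\<Sum>j\<le>k. ?L j x * coord_deriv (U, z) 1 w x * b (Suc j) x)"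
    unfolding sum.distrib[symmetric]
    by (intro sum.cong refl) (simp only: coord_deriv_mult[OF cx hL hb] Db, simp only: mult_ac)
  \<comment> \<open>\<open>?L (Suc k)\<close> is the zero function, so the range can be extended to
    match that of the shifted sum.\<close>
  also have "(\<Sum>j\<le>k. coord_deriv (U, z) 1 (?L j) x * b j x) =
      (\<Sum>j\<le>Suc k. coord_deriv (U, z) 1 (?L j) x * b j x)"
    by (simp add: leibniz_coeff_zero)
  \<comment> \<open>Index shift; the new term j = 0 is the zero of the \<open>if\<close> in
    \<open>leibniz_coeff\<close>.\<close>
  also have "(\<Sum>j\<le>k. ?L j x * coord_deriv (U, z) 1 w x * b (Suc j) x) =
      (\<Sum>j\<le>Suc k. (if j = 0 then 0 else ?L (j - 1) x * coord_deriv (U, z) 1 w x) * b j x)"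
    by (subst sum.atMost_Suc_shift) simp
  finally show ?case
    unfolding sum.distrib[symmetric] by (simp add: b_def algebra_simps)
qed

section \<open>The Wronskian determinant before removal of singularities\<close>

definition wdet :: "nat \<Rightarrow> 'a chart \<Rightarrow> ('e \<Rightarrow> complex vec) \<Rightarrow> ('a \<Rightarrow> 'e) \<Rightarrow> 'a \<Rightarrow> complex" where
  "wdet n c \<phi> A x = det (wronskian_matrix n c \<phi> A x)"

text \<open>\<open>wdet\<close> keeps the raw values: matrix identities and derivatives are computed
  for it at good points, while \<open>wronskian\<close> is its canonical representative.\<close>

lemma wronskian_eq: "wronskian R n c \<phi> A = mero_val R (wdet n c \<phi> A)"
  by (simp add: wronskian_def wdet_def[abs_def])

lemma wronskian_matrix_carrier [simp]: "wronskian_matrix n c \<phi> A x \<in> carrier_mat n n"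
  by (simp add: wronskian_matrix_def)

text \<open>M mixes derivatives from the left, T mixes components from the right; the transpose
  turns into multiplication by T because the components form the columns of the matrix.\<close>

lemma wdet_change:
  fixes \<phi> \<psi> :: "'e \<Rightarrow> complex vec"
  assumes c: "coord_chart R (U, z)" and d: "coord_chart R (V, w)"
    and S: "openin X S" "S \<subseteq> U \<inter> V"
    and \<mu>: "\<And>y. y \<in> S \<Longrightarrow> hol_at \<mu> y"
    and a: "\<And>r y. r < n \<Longrightarrow> y \<in> S \<Longrightarrow> hol_at (\<lambda>y. \<psi> (A y) $ r) y"
    and T: "T \<in> carrier_mat n n"
    and \<psi>: "\<And>y. y \<in> S \<Longrightarrow> \<psi> (A y) \<in> carrier_vec n"
    and f: "\<And>y. y \<in> S \<Longrightarrow> \<phi> (A y) = \<mu> y \<cdot>\<^sub>v (transpose_mat T *\<^sub>v \<psi> (A y))"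
    and x: "x \<in> S"
  shows "wdet n (U, z) \<phi> A x =
    (\<Prod>k<n. \<mu> x * coord_deriv (U, z) 1 w x ^ k) * det T * wdet n (V, w) \<psi> A x"
proof -
  define M where "M = mat n n (\<lambda>(k, j). leibniz_coeff (U, z) w \<mu> k j x)"
  let ?W = "wronskian_matrix n (V, w) \<psi> A x"
  have M: "M \<in> carrier_mat n n" by (simp add: M_def)
  have W: "?W \<in> carrier_mat n n" by simp
  have "wronskian_matrix n (U, z) \<phi> A x = M * (?W * T)"
  proof (rule eq_matI)
    fix k l assume "k < dim_row (M * (?W * T))" "l < dim_col (M * (?W * T))"
    then have kl: "k < n" "l < n" using M T by auto
    have f': "\<phi> (A y) $ l = \<mu> y * (\<Sum>r<n. T $$ (r, l) * \<psi> (A y) $ r)" if "y \<in> S" for y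
      using kl T \<psi>[OF that] f[OF that]
      by (auto simp: scalar_prod_def lessThan_atLeast0 intro!: sum.cong)
    have "wronskian_matrix n (U, z) \<phi> A x $$ (k, l) = coord_deriv (U, z) k (\<lambda>y. \<phi> (A y) $ l) x"
      using kl by (simp add: wronskian_matrix_def)
    also have "\<dots> = (\<Sum>j\<le>k. leibniz_coeff (U, z) w \<mu> k j x *
        (\<Sum>r<n. T $$ (r, l) * coord_deriv (V, w) j (\<lambda>y. \<psi> (A y) $ r) x))"
      by (rule coord_deriv_change[where a = "\<lambda>r y. \<psi> (A y) $ r", OF c d S \<mu> a f' x])
    \<comment> \<open>Extends the range from j \<le> k to j < n; the added coefficients lie above
      the diagonal and are zero.\<close>
    also have "\<dots> = (\<Sum>j<n. leibniz_coeff (U, z) w \<mu> k j x *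
        (\<Sum>r<n. T $$ (r, l) * coord_deriv (V, w) j (\<lambda>y. \<psi> (A y) $ r) x))"
      using kl by (intro sum.mono_neutral_left) (auto simp: leibniz_coeff_zero)
    also have "\<dots> = (M * (?W * T)) $$ (k, l)"
      using kl T by (auto simp: M_def scalar_prod_def lessThan_atLeast0 wronskian_matrix_def mult.commute
          intro!: sum.cong)
    finally show "wronskian_matrix n (U, z) \<phi> A x $$ (k, l) = (M * (?W * T)) $$ (k, l)" .
  qed (use M T in \<open>auto simp: wronskian_matrix_def\<close>)
  then have "wdet n (U, z) \<phi> A x = det M * (det ?W * det T)"
    using det_mult[OF M mult_carrier_mat[OF W T]] det_mult[OF W T]
    by (simp add: wdet_def)
  moreover have "det M = (\<Prod>k<n. \<mu> x * coord_deriv (U, z) 1 w x ^ k)"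
  proof -
    have "det M = prod_list (diag_mat M)"
      by (rule det_lower_triangular[OF _ M]) (simp add: M_def leibniz_coeff_zero)
    also have "\<dots> = (\<Prod>k<n. leibniz_coeff (U, z) w \<mu> k k x)"
      by (simp add: prod_list_diag_prod M_def lessThan_atLeast0)
    finally show ?thesis by (simp only: leibniz_coeff_diag)
  qed
  ultimately show ?thesis by (simp add: wdet_def mult_ac)
qed

lemma mer_at_wdet:
  fixes \<phi> :: "'e \<Rightarrow> complex vec"
  assumes c: "coord_chart R (U, z)" "x \<in> U" and a: "\<And>l. l < n \<Longrightarrow> mer_at (\<lambda>y. \<phi> (A y) $ l) x"
  shows "mer_at (wdet n (U, z) \<phi> A) x"
proof -
  have "wdet n (U, z) \<phi> A = (\<lambda>y. \<Sum>p\<in>{p. p permutes {0..<n}}. signof p *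
      (\<Prod>k = 0..<n. coord_deriv (U, z) k (\<lambda>y. \<phi> (A y) $ p k) y))"
  proof
    fix y
    have "wronskian_matrix n (U, z) \<phi> A y $$ (k, p k) = coord_deriv (U, z) k (\<lambda>y. \<phi> (A y) $ p k) y"
      if "p permutes {0..<n}" "k < n" for p k
      using that permutes_in_image[OF that(1), of k] by (simp add: wronskian_matrix_def)
    then show "wdet n (U, z) \<phi> A y = (\<Sum>p\<in>{p. p permutes {0..<n}}. signof p *
        (\<Prod>k = 0..<n. coord_deriv (U, z) k (\<lambda>y. \<phi> (A y) $ p k) y))"
      unfolding wdet_def det_def'[OF wronskian_matrix_carrier]
      by (intro sum.cong refl arg_cong2[where f = times] prod.cong) auto
  qed
  moreover have "mer_at \<dots> x"
  proof (intro mer_at_sum mer_at_mult mer_at_prod mer_at_const chart_points[OF c])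
    fix p k assume "p \<in> {p. p permutes {0..<n}}" "k \<in> {0..<n}"
    then have "p k < n" using permutes_in_image[of p "{0..<n}" k] by simp
    then show "mer_at (coord_deriv (U, z) k (\<lambda>y. \<phi> (A y) $ p k)) x"
      by (intro mer_at_coord_deriv[OF c] a)
  qed
  ultimately show ?thesis by simp
qed

text \<open>The product rule for each term of the permutation expansion, regrouped by the row that
  is differentiated.\<close>

lemma coord_deriv_det:
  fixes M :: "'a \<Rightarrow> complex mat"
  assumes c: "coord_chart R (U, z)" "x \<in> U"
    and M: "\<And>y. M y \<in> carrier_mat n n"
    and h: "\<And>i j. i < n \<Longrightarrow> j < n \<Longrightarrow> hol_at (\<lambda>y. M y $$ (i, j)) x"
  shows "coord_deriv (U, z) 1 (\<lambda>y. det (M y)) x =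
    (\<Sum>k<n. det (mat n n (\<lambda>(i, j). if i = k then coord_deriv (U, z) 1 (\<lambda>y. M y $$ (i, j)) x
      else M x $$ (i, j))))"
proof -
  let ?D = "coord_deriv (U, z) 1"
  let ?N = "\<lambda>k. mat n n (\<lambda>(i, j). if i = k then ?D (\<lambda>y. M y $$ (i, j)) x else M x $$ (i, j))"
  let ?S = "{p. p permutes {0..<n}}"
  have pt: "x \<in> points R" using chart_points[OF c] .
  have p: "p i < n" if "p \<in> ?S" "i < n" for p i
    using that permutes_in_image[of p "{0..<n}" i] by simp
  have hp: "hol_at (\<lambda>y. \<Prod>i = 0..<n. M y $$ (i, p i)) x" if "p \<in> ?S" for p
    using p[OF that] pt by (intro hol_at_prod h) auto
  have "?D (\<lambda>y. det (M y)) x = ?D (\<lambda>y. \<Sum>p\<in>?S. signof p * (\<Prod>i = 0..<n. M y $$ (i, p i))) x"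
    unfolding det_def'[OF M] ..
  also have "\<dots> = (\<Sum>p\<in>?S. ?D (\<lambda>y. signof p * (\<Prod>i = 0..<n. M y $$ (i, p i))) x)"
    by (intro coord_deriv_sum[OF c] hol_at_mult hol_at_const pt hp)
  also have "\<dots> = (\<Sum>p\<in>?S. \<Sum>k<n. signof p * (\<Prod>i = 0..<n. ?N k $$ (i, p i)))"
  proof (rule sum.cong[OF refl])
    fix p assume q: "p \<in> ?S"
    have "?D (\<lambda>y. signof p * (\<Prod>i = 0..<n. M y $$ (i, p i))) x =
        signof p * ?D (\<lambda>y. \<Prod>i = 0..<n. M y $$ (i, p i)) x"
      using coord_deriv_mult[OF c hol_at_const[OF pt] hp[OF q], of "signof p"] by simp
    also have "?D (\<lambda>y. \<Prod>i = 0..<n. M y $$ (i, p i)) x =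
        (\<Sum>k<n. ?D (\<lambda>y. M y $$ (k, p k)) x * (\<Prod>i\<in>{0..<n} - {k}. M x $$ (i, p i)))"
      unfolding lessThan_atLeast0 using p[OF q] by (intro coord_deriv_prod[OF c] h) auto
    also have "\<dots> = (\<Sum>k<n. \<Prod>i = 0..<n. ?N k $$ (i, p i))"
    proof (rule sum.cong[OF refl])
      fix k assume k: "k \<in> {..<n}"
      have "(\<Prod>i = 0..<n. ?N k $$ (i, p i)) =
          ?N k $$ (k, p k) * (\<Prod>i\<in>{0..<n} - {k}. ?N k $$ (i, p i))"
        using k by (intro prod.remove) auto
      also have "(\<Prod>i\<in>{0..<n} - {k}. ?N k $$ (i, p i)) = (\<Prod>i\<in>{0..<n} - {k}. M x $$ (i, p i))"
        using p[OF q] by (intro prod.cong) auto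
      finally show "?D (\<lambda>y. M y $$ (k, p k)) x * (\<Prod>i\<in>{0..<n} - {k}. M x $$ (i, p i)) =
          (\<Prod>i = 0..<n. ?N k $$ (i, p i))"
        using k p[OF q, of k] by simp
    qed
    finally show "?D (\<lambda>y. signof p * (\<Prod>i = 0..<n. M y $$ (i, p i))) x =
        (\<Sum>k<n. signof p * (\<Prod>i = 0..<n. ?N k $$ (i, p i)))"
      by (simp only: sum_distrib_left)
  qed
  also have "\<dots> = (\<Sum>k<n. \<Sum>p\<in>?S. signof p * (\<Prod>i = 0..<n. ?N k $$ (i, p i)))"
    by (rule sum.swap)
  also have "\<dots> = (\<Sum>k<n. det (?N k))"
    by (intro sum.cong refl det_def'[symmetric]) simp
  finally show ?thesis .
qed

text \<open>The equation for the n-th derivatives expresses the new last row through the old rows,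
  that is, by a left factor \<open>?E\<close> equal to the identity except in its last row. Its
  determinant is the last diagonal entry \<open>q 1\<close>.\<close>

lemma coord_deriv_wdet:
  fixes \<phi> :: "'e \<Rightarrow> complex vec"
  assumes c: "coord_chart R (U, z)" "x \<in> U" and n: "n \<ge> 1"
    and a: "\<And>l. l < n \<Longrightarrow> hol_at (\<lambda>y. \<phi> (A y) $ l) x"
    and q: "\<And>l. l < n \<Longrightarrow> coord_deriv (U, z) n (\<lambda>y. \<phi> (A y) $ l) x =
      (\<Sum>k = 1..n. q k * coord_deriv (U, z) (n - k) (\<lambda>y. \<phi> (A y) $ l) x)"
  shows "coord_deriv (U, z) 1 (wdet n (U, z) \<phi> A) x = q 1 * wdet n (U, z) \<phi> A x"
proof -
  let ?W = "wronskian_matrix n (U, z) \<phi> A"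
  let ?d = "\<lambda>k l. coord_deriv (U, z) k (\<lambda>y. \<phi> (A y) $ l) x"
  let ?N = "\<lambda>k. mat n n (\<lambda>(i, j). if i = k then ?d (Suc i) j else ?d i j)"
  have W: "?W x \<in> carrier_mat n n" by simp
  have ent: "(\<lambda>y. ?W y $$ (i, j)) = coord_deriv (U, z) i (\<lambda>y. \<phi> (A y) $ j)" if "i < n" "j < n" for i j
    using that by (simp add: wronskian_matrix_def)
  have "coord_deriv (U, z) 1 (\<lambda>y. det (?W y)) x =
      (\<Sum>k<n. det (mat n n (\<lambda>(i, j). if i = k then coord_deriv (U, z) 1 (\<lambda>y. ?W y $$ (i, j)) x
        else ?W x $$ (i, j))))"
    using a hol_at_coord_deriv[OF c] by (intro coord_deriv_det[OF c]) (simp_all add: ent)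
  also have "\<dots> = (\<Sum>k<n. det (?N k))"
  proof (rule sum.cong[OF refl], rule arg_cong[of _ _ det], rule cong_mat[OF refl refl], unfold prod.case)
    fix k i j assume ij: "i < n" "j < n"
    show "(if i = k then coord_deriv (U, z) 1 (\<lambda>y. ?W y $$ (i, j)) x else ?W x $$ (i, j)) =
        (if i = k then ?d (Suc i) j else ?d i j)"
      unfolding ent[OF ij] using ij
      by (simp add: wronskian_matrix_def coord_deriv_Suc[OF c, of k] del: One_nat_def)
  qed
  also have "\<dots> = (\<Sum>k\<in>{n - 1}. det (?N k))"
  proof (rule sum.mono_neutral_right)
    show "\<forall>k\<in>{..<n} - {n - 1}. det (?N k) = 0"
    proof
      fix k assume "k \<in> {..<n} - {n - 1}"
      then have k: "k < n" "Suc k < n" by auto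
      \<comment> \<open>Differentiating a row other than the last produces a copy of the row below
        it.\<close>
      have "row (?N k) k = row (?N k) (Suc k)"
        using k by (intro eq_vecI) auto
      then show "det (?N k) = 0"
        using k by (intro det_identical_rows[of "?N k" n k "Suc k"]) auto
    qed
  qed (use n in auto)
  also have "\<dots> = det (?N (n - 1))" by simp
  \<comment> \<open>Column j of the last row carries \<open>q (n - j)\<close>, the coefficient of
    the j-th derivative, so \<open>q 1\<close> stands at j = n - 1.\<close>
  also have "?N (n - 1) = mat n n (\<lambda>(i, j). if i = n - 1 then q (n - j) else if i = j then 1 else 0) * ?W x"
    (is "_ = ?E * _")
  proof (rule eq_matI)
    fix i l assume "i < dim_row (?E * ?W x)" "l < dim_col (?E * ?W x)"
    then have il: "i < n" "l < n" by (auto simp: wronskian_matrix_def)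
    have prod: "(?E * ?W x) $$ (i, l) =
        (\<Sum>j<n. (if i = n - 1 then q (n - j) else if i = j then 1 else 0) * ?d j l)"
      using il by (auto simp: scalar_prod_def wronskian_matrix_def lessThan_atLeast0 intro!: sum.cong)
    show "?N (n - 1) $$ (i, l) = (?E * ?W x) $$ (i, l)"
    proof (cases "i = n - 1")
      case True
      have "?N (n - 1) $$ (i, l) = ?d n l" using il True by simp
      also have "\<dots> = (\<Sum>k = 1..n. q k * ?d (n - k) l)" by (rule q[OF il(2)])
      also have "\<dots> = (\<Sum>j<n. q (n - j) * ?d j l)"
        by (rule sum.reindex_bij_witness[of _ "\<lambda>j. n - j" "\<lambda>k. n - k"]) auto
      finally show ?thesis unfolding prod using True by simp
    next
      case False
      then show ?thesis unfolding prod using il by (simp add: if_distrib[of "\<lambda>t. t * _"] sum.delta cong: if_cong)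
    qed
  qed (auto simp: wronskian_matrix_def)
  also have "det (?E * ?W x) = det ?E * det (?W x)"
    by (rule det_mult[OF _ W]) simp
  also have "det ?E = (\<Prod>i<n. if i = n - 1 then q 1 else 1)"
  proof -
    have "det ?E = prod_list (diag_mat ?E)"
      by (rule det_lower_triangular[of n]) auto
    also have "\<dots> = (\<Prod>i<n. if i = n - 1 then q 1 else 1)"
      unfolding prod_list_diag_prod by (rule prod.cong) auto
    finally show ?thesis .
  qed
  also have "\<dots> = q 1" using n by (simp add: prod.delta)
  finally show ?thesis by (simp add: wdet_def[abs_def])
qed

section \<open>The line bundle of a divisor and its Chern class\<close>

text \<open>In rank one the transition matrix is its single entry, so compatibility amounts to a
  nowhere zero holomorphic factor; \<open>triv_compatible_lineE\<close> extracts it again.\<close>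

lemma triv_compatible_lineI:
  fixes \<phi> \<psi> :: "'l \<Rightarrow> complex vec"
  assumes o: "openin X (U \<inter> V)" and h: "\<And>x. x \<in> U \<inter> V \<Longrightarrow> hol_at h x" "\<And>x. x \<in> U \<inter> V \<Longrightarrow> h x \<noteq> 0"
    and \<psi>: "\<And>x e. x \<in> U \<inter> V \<Longrightarrow> e \<in> fibre L x \<Longrightarrow> \<psi> e \<in> carrier_vec 1 \<and> \<phi> e = h x \<cdot>\<^sub>v \<psi> e"
  shows "triv_compatible R 1 L (U, \<phi>) (V, \<psi>)"
  unfolding triv_compatible_def prod.case
proof (intro exI[of _ "\<lambda>x. mat 1 1 (\<lambda>_. h x)"] conjI ballI allI impI)
  fix x assume x: "x \<in> U \<inter> V"
  show "invertible_mat (mat 1 1 (\<lambda>_. h x))" using invertible_mat_1x1 h(2)[OF x] .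
  fix e assume "e \<in> fibre L x"
  then show "\<phi> e = transpose_mat (mat 1 1 (\<lambda>_. h x)) *\<^sub>v \<psi> e"
    using \<psi>[OF x] by (subst transpose_1x1_mult) auto
qed (use h(1) in \<open>auto simp: holo_on_iff[OF o]\<close>)

lemma triv_compatible_lineE:
  fixes \<phi> \<psi> :: "'l \<Rightarrow> complex vec"
  assumes c: "triv_compatible R 1 L (U, \<phi>) (V, \<psi>)" and o: "openin X (U \<inter> V)"
    and \<psi>: "\<And>x e. x \<in> U \<inter> V \<Longrightarrow> e \<in> fibre L x \<Longrightarrow> \<psi> e \<in> carrier_vec 1"
  obtains h where "\<And>x. x \<in> U \<inter> V \<Longrightarrow> hol_at h x" "\<And>x. x \<in> U \<inter> V \<Longrightarrow> h x \<noteq> 0"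
    "\<And>x e. x \<in> U \<inter> V \<Longrightarrow> e \<in> fibre L x \<Longrightarrow> \<phi> e = h x \<cdot>\<^sub>v \<psi> e"
proof -
  obtain g where g0: "(\<forall>x\<in>U \<inter> V. g x \<in> carrier_mat 1 1 \<and> invertible_mat (g x) \<and>
        (\<forall>e\<in>fibre L x. \<phi> e = transpose_mat (g x) *\<^sub>v \<psi> e)) \<and>
      (\<forall>k<1. \<forall>l<1. holo_on R (U \<inter> V) (\<lambda>x. g x $$ (k, l)))"
    using c unfolding triv_compatible_def prod.case by (rule exE)
  have g: "g x \<in> carrier_mat 1 1" "invertible_mat (g x)" if "x \<in> U \<inter> V" for x
    using g0 that by blast+
  have g_eq: "\<phi> e = transpose_mat (g x) *\<^sub>v \<psi> e" if "x \<in> U \<inter> V" "e \<in> fibre L x" for x e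
    using g0 that by blast
  have g_holo: "holo_on R (U \<inter> V) (\<lambda>x. g x $$ (0, 0))"
    using g0 by simp
  show thesis
  proof (rule that[of "\<lambda>x. g x $$ (0, 0)"])
    fix x assume x: "x \<in> U \<inter> V"
    show "hol_at (\<lambda>x. g x $$ (0, 0)) x" using g_holo x unfolding holo_on_iff[OF o] by (rule bspec)
    have "det (g x) \<noteq> 0" by (rule invertible_mat_det_nonzero[OF g[OF x]])
    then show "g x $$ (0, 0) \<noteq> 0"
      using det_single[of "g x"] g(1)[OF x] by simp
    fix e assume e: "e \<in> fibre L x"
    show "\<phi> e = g x $$ (0, 0) \<cdot>\<^sub>v \<psi> e"
      unfolding g_eq[OF x e] by (rule transpose_1x1_mult[OF g(1)[OF x] \<psi>[OF x e]])
  qed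
qed

section \<open>Local equations of a divisor and their quotients\<close>

lemma local_equation_mer_at:
  assumes "(V, s) \<in> local_equations R D" "x \<in> V"
  shows "mer_at s x" "eventually (\<lambda>y. s y \<noteq> 0) (atin X x)" "ord_at R s x = D x"
proof -
  have V: "openin X V" "mero_on R V s" "\<not> eventually (\<lambda>y. s y = 0) (atin X x)" "ord_at R s x = D x"
    using assms by (auto simp: local_equations_def)
  show m: "mer_at s x" using V(1,2) assms(2) mero_on_iff openin_subset by blast
  show "eventually (\<lambda>y. s y \<noteq> 0) (atin X x)" using mer_at_dichotomy[OF m] V(3) by blast
qed (use assms in \<open>auto simp: local_equations_def\<close>)

text \<open>Local equations of one divisor have equal orders at x, so the quotient has a removable
  singularity and a non-zero value.\<close>

lemma local_equation_ratio:
  assumes s: "(V, s) \<in> local_equations R D" "x \<in> V" and t: "(W, t) \<in> local_equations R D" "x \<in> W"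
  shows "((\<lambda>y. s y / t y) \<longlongrightarrow> mero_val R (\<lambda>y. s y / t y) x) (atin X x)"
    and "mero_val R (\<lambda>y. s y / t y) x \<noteq> 0"
    and "hol_at (mero_val R (\<lambda>y. s y / t y)) x"
proof -
  note sx = local_equation_mer_at[OF s] and tx = local_equation_mer_at[OF t]
  have "ord_at R s x = ord_at R t x" using sx(3) tx(3) by simp
  then obtain l where l: "l \<noteq> 0" "((\<lambda>y. s y / t y) \<longlongrightarrow> l) (atin X x)"
    using ord_at_eq_ratio[OF sx(1,2) tx(1,2)] by blast
  have eq: "mero_val R (\<lambda>y. s y / t y) x = l"
    by (rule mero_val_tendsto[OF l(2) mer_at_points[OF sx(1)]])
  show "((\<lambda>y. s y / t y) \<longlongrightarrow> mero_val R (\<lambda>y. s y / t y) x) (atin X x)"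
    "mero_val R (\<lambda>y. s y / t y) x \<noteq> 0"
    using l eq by simp_all
  show "hol_at (mero_val R (\<lambda>y. s y / t y)) x"
    by (rule hol_at_mero_val[OF mer_at_divide[OF sx(1) tx(1)] l(2)])
qed

text \<open>\<open>mero_val\<close> is not multiplicative in general, since it is 0 at poles; here
  all three quotients have limits, and limits multiply.\<close>

lemma local_equation_cocycle:
  assumes s: "(V, s) \<in> local_equations R D" "x \<in> V" and t: "(W, t) \<in> local_equations R D" "x \<in> W"
    and r: "(Y, r) \<in> local_equations R D" "x \<in> Y"
  shows "mero_val R (\<lambda>y. s y / t y) x * mero_val R (\<lambda>y. t y / r y) x = mero_val R (\<lambda>y. s y / r y) x"
proof -
  have "((\<lambda>y. (s y / t y) * (t y / r y)) \<longlongrightarrow>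
      mero_val R (\<lambda>y. s y / t y) x * mero_val R (\<lambda>y. t y / r y) x) (atin X x)"
    by (intro tendsto_mult local_equation_ratio(1)[OF s t] local_equation_ratio(1)[OF t r])
  moreover have "eventually (\<lambda>y. (s y / t y) * (t y / r y) = s y / r y) (atin X x)"
    using local_equation_mer_at(2)[OF t] by eventually_elim simp
  ultimately have "((\<lambda>y. s y / r y) \<longlongrightarrow>
      mero_val R (\<lambda>y. s y / t y) x * mero_val R (\<lambda>y. t y / r y) x) (atin X x)"
    by (rule Lim_transform_eventually)
  then show ?thesis
    using mero_val_tendsto mer_at_points[OF local_equation_mer_at(1)[OF s]] by metis
qed

text \<open>At a zero of s the quotient is 0 / 0 = 0, so the value 1 is obtained as a limit.\<close>

lemma local_equation_self:
  assumes s: "(V, s) \<in> local_equations R D" "x \<in> V"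
  shows "mero_val R (\<lambda>y. s y / s y) x = 1"
proof -
  have x: "x \<in> points R" using mer_at_points[OF local_equation_mer_at(1)[OF s]] .
  have "eventually (\<lambda>y. s y / s y = 1) (atin X x)"
    using local_equation_mer_at(2)[OF s] by eventually_elim simp
  from mero_val_cong[OF this] show ?thesis using mero_val_hol[OF hol_at_const[OF x]] by simp
qed

section \<open>Fibres and trivializations of the line bundle of a divisor\<close>

definition divisor_triv :: "'a set \<times> ('a \<Rightarrow> complex) \<Rightarrow> 'a \<times> ('a set \<times> ('a \<Rightarrow> complex) \<Rightarrow> complex) \<Rightarrow> complex vec"
  where "divisor_triv k = (\<lambda>(x, u). vec 1 (\<lambda>_. u k))"

lemma divisor_triv_mem:
  "(V, s) \<in> local_equations R D \<Longrightarrow> (V, divisor_triv (V, s)) \<in> trivs (divisor_line_bundle R D)"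
  by (force simp: divisor_line_bundle_def glued_line_bundle_def divisor_triv_def)

lemma divisor_triv_cases:
  assumes "t \<in> trivs (divisor_line_bundle R D)"
  obtains V s where "(V, s) \<in> local_equations R D" "t = (V, divisor_triv (V, s))"
  using assms by (auto simp: divisor_line_bundle_def glued_line_bundle_def divisor_triv_def)

lemma divisor_fibre:
  "(y, u) \<in> fibre (divisor_line_bundle R D) x \<longleftrightarrow> y = x \<and> x \<in> points R \<and>
    (\<forall>k. \<not> (k \<in> local_equations R D \<and> x \<in> fst k) \<longrightarrow> u k = 0) \<and>
    (\<forall>k\<in>local_equations R D. \<forall>k'\<in>local_equations R D. x \<in> fst k \<inter> fst k' \<longrightarrow>
      u k = mero_val R (\<lambda>y. snd k y / snd k' y) x * u k')"
proof -
  have "(y, u) \<in> fibre (divisor_line_bundle R D) x \<longleftrightarrow> (y \<in> points R \<and>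
      (\<forall>k. \<not> (k \<in> local_equations R D \<and> y \<in> fst k) \<longrightarrow> u k = 0) \<and>
      (\<forall>k\<in>local_equations R D. \<forall>k'\<in>local_equations R D. y \<in> fst k \<inter> fst k' \<longrightarrow>
        u k = mero_val R (\<lambda>y. snd k y / snd k' y) y * u k')) \<and> y = x"
    by (simp only: fibre_def divisor_line_bundle_def glued_line_bundle_def mem_Collect_eq
        vbundle.simps prod.case fst_conv snd_conv case_prod_beta)
  then show ?thesis by blast
qed

lemma divisor_fibre_eq:
  assumes "(y, u) \<in> fibre (divisor_line_bundle R D) x"
    and "(V, s) \<in> local_equations R D" "x \<in> V" "(W, t) \<in> local_equations R D" "x \<in> W"
  shows "u (V, s) = mero_val R (\<lambda>y. s y / t y) x * u (W, t)"
proof -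
  have "\<forall>k\<in>local_equations R D. \<forall>k'\<in>local_equations R D. x \<in> fst k \<inter> fst k' \<longrightarrow>
      u k = mero_val R (\<lambda>y. snd k y / snd k' y) x * u k'"
    using assms(1) unfolding divisor_fibre by (elim conjE)
  from bspec[OF bspec[OF this assms(2)] assms(4)] show ?thesis using assms(3,5) by simp
qed

lemma divisor_fibre_zero:
  assumes "(y, u) \<in> fibre (divisor_line_bundle R D) x" "\<not> ((V, s) \<in> local_equations R D \<and> x \<in> V)"
  shows "u (V, s) = 0"
proof -
  have "\<forall>k. \<not> (k \<in> local_equations R D \<and> x \<in> fst k) \<longrightarrow> u k = 0"
    using assms(1) unfolding divisor_fibre by (elim conjE)
  from spec[OF this, of "(V, s)"] show ?thesis using assms(2) by simp
qed

lemma divisor_triv_carrier [simp]: "divisor_triv k e \<in> carrier_vec 1"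
  by (auto simp: divisor_triv_def split: prod.splits)

lemma divisor_triv_transition:
  assumes s: "(V, s) \<in> local_equations R D" "x \<in> V" and t: "(W, t) \<in> local_equations R D" "x \<in> W"
    and e: "e \<in> fibre (divisor_line_bundle R D) x"
  shows "divisor_triv (V, s) e = mero_val R (\<lambda>y. s y / t y) x \<cdot>\<^sub>v divisor_triv (W, t) e"
proof -
  obtain y u where yu: "e = (y, u)" by (cases e)
  have "u (V, s) = mero_val R (\<lambda>y. s y / t y) x * u (W, t)"
    by (rule divisor_fibre_eq[OF e[unfolded yu] s t])
  then show ?thesis by (auto simp: divisor_triv_def yu intro!: eq_vecI)
qed

text \<open>A fibre vector is determined by its coordinate at one local equation, and the cocycle
  relation makes every value of that coordinate possible.\<close>

lemma divisor_triv_bij: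
  assumes s: "(V, s) \<in> local_equations R D" "x \<in> V"
  shows "bij_betw (divisor_triv (V, s)) (fibre (divisor_line_bundle R D) x) (carrier_vec 1)"
proof -
  have x: "x \<in> points R" using mer_at_points[OF local_equation_mer_at(1)[OF s]] .
  let ?F = "fibre (divisor_line_bundle R D) x"
  \<comment> \<open>The vector with coordinate c at s has coordinate (t / s) c at t, and 0 at the
    indices without a coordinate at x.\<close>
  define b where "b c = (x, \<lambda>(W, t). if (W, t) \<in> local_equations R D \<and> x \<in> W
      then mero_val R (\<lambda>y. t y / s y) x * c else 0)" for c
  have bF: "b c \<in> ?F" for c
    unfolding b_def divisor_fibre
  proof (intro conjI allI ballI impI)
    fix k k' assume k: "k \<in> local_equations R D" "k' \<in> local_equations R D" "x \<in> fst k \<inter> fst k'"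
    obtain V1 s1 V2 s2 where k': "k = (V1, s1)" "k' = (V2, s2)" by (cases k, cases k')
    have "mero_val R (\<lambda>y. s1 y / s y) x =
        mero_val R (\<lambda>y. s1 y / s2 y) x * mero_val R (\<lambda>y. s2 y / s y) x"
      using local_equation_cocycle[OF _ _ _ _ s] k unfolding k' by simp
    then show "(\<lambda>(W, t). if (W, t) \<in> local_equations R D \<and> x \<in> W
          then mero_val R (\<lambda>y. t y / s y) x * c else 0) k =
        mero_val R (\<lambda>y. snd k y / snd k' y) x * (\<lambda>(W, t). if (W, t) \<in> local_equations R D \<and> x \<in> W
          then mero_val R (\<lambda>y. t y / s y) x * c else 0) k'"
      using k unfolding k' by simp
  qed (use x in \<open>auto split: prod.splits\<close>)
  have inj: "b (divisor_triv (V, s) e $ 0) = e" if e: "e \<in> ?F" for e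
  proof -
    obtain y u where yu: "e = (y, u)" by (cases e)
    have u: "u (W, t) = (if (W, t) \<in> local_equations R D \<and> x \<in> W
        then mero_val R (\<lambda>y. t y / s y) x * u (V, s) else 0)" for W t
    proof (cases "(W, t) \<in> local_equations R D \<and> x \<in> W")
      case True
      then have "u (W, t) = mero_val R (\<lambda>y. t y / s y) x * u (V, s)"
        using divisor_fibre_eq[OF e[unfolded yu] _ _ s] by blast
      then show ?thesis unfolding if_P[OF True] .
    next
      case False
      then have "u (W, t) = 0" by (rule divisor_fibre_zero[OF e[unfolded yu]])
      then show ?thesis unfolding if_not_P[OF False] .
    qed
    have "y = x" using e unfolding yu divisor_fibre by blast
    moreover have "divisor_triv (V, s) e $ 0 = u (V, s)"
      by (simp add: divisor_triv_def yu)
    moreover have "(\<lambda>(W, t). if (W, t) \<in> local_equations R D \<and> x \<in> W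
        then mero_val R (\<lambda>y. t y / s y) x * u (V, s) else 0) = u"
      by (rule ext, clarify) (simp only: prod.case u[symmetric])
    ultimately show ?thesis by (simp add: b_def yu)
  qed
  have surj: "divisor_triv (V, s) (b (v $ 0)) = v" if v: "v \<in> carrier_vec 1" for v
    using v s local_equation_self[OF s] by (auto simp: b_def divisor_triv_def intro!: eq_vecI)
  show ?thesis
  proof (rule bij_betw_byWitness[of _ "\<lambda>v :: complex vec. b (v $ 0)"])
    show "divisor_triv (V, s) ` ?F \<subseteq> carrier_vec 1" using divisor_triv_carrier by blast
  qed (use inj surj bF in blast)+
qed

lemma divisor_triv_holo:
  assumes s: "(V, s) \<in> local_equations R D"
  shows "holo_triv R 1 (divisor_line_bundle R D) (V, divisor_triv (V, s))"
  unfolding holo_triv_def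
proof
  have o: "openin X V" if "(V, s) \<in> local_equations R D" for V s
    using that by (simp add: local_equations_def)
  show "is_triv R 1 (divisor_line_bundle R D) (V, divisor_triv (V, s))"
    using o[OF s] divisor_triv_bij[OF s] by (simp add: is_triv_def)
  show "\<forall>t\<in>trivs (divisor_line_bundle R D).
      triv_compatible R 1 (divisor_line_bundle R D) (V, divisor_triv (V, s)) t"
  proof
    fix k assume "k \<in> trivs (divisor_line_bundle R D)"
    then obtain W t where t: "(W, t) \<in> local_equations R D" "k = (W, divisor_triv (W, t))"
      by (rule divisor_triv_cases)
    show "triv_compatible R 1 (divisor_line_bundle R D) (V, divisor_triv (V, s)) k"
      unfolding t(2)
    proof (rule triv_compatible_lineI)
      show "openin X (V \<inter> W)" using o[OF s] o[OF t(1)] by blast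
      fix x assume "x \<in> V \<inter> W"
      then have x: "x \<in> V" "x \<in> W" by auto
      show "hol_at (mero_val R (\<lambda>y. s y / t y)) x" "mero_val R (\<lambda>y. s y / t y) x \<noteq> 0"
        by (rule local_equation_ratio[OF s x(1) t(1) x(2)])+
      fix e assume "e \<in> fibre (divisor_line_bundle R D) x"
      from divisor_triv_transition[OF s x(1) t(1) x(2) this]
      show "divisor_triv (W, t) e \<in> carrier_vec 1 \<and>
          divisor_triv (V, s) e = mero_val R (\<lambda>y. s y / t y) x \<cdot>\<^sub>v divisor_triv (W, t) e"
        by (intro conjI divisor_triv_carrier)
    qed
  qed
qed

section \<open>Logarithmic differentials and Cech classes\<close>

lemma dlog_eq:
  "dlog R V g c x = (if coord_chart R c \<and> x \<in> fst c \<inter> V then coord_deriv c 1 g x / g x else 0)"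
  by (simp add: dlog_def fun_diff_def)

lemma dlog_in_holo_forms:
  assumes V: "openin X V" and g: "\<And>x. x \<in> V \<Longrightarrow> hol_at g x" "\<And>x. x \<in> V \<Longrightarrow> g x \<noteq> 0"
  shows "dlog R V g \<in> holo_forms R V"
  unfolding holo_forms_def mem_Collect_eq
proof (intro conjI allI impI ballI)
  fix c x assume "\<not> (coord_chart R c \<and> x \<in> fst c \<inter> V)"
  then show "dlog R V g c x = 0" by (auto simp: dlog_eq)
next
  fix W \<zeta> assume c: "coord_chart R (W, \<zeta>)"
  have o: "openin X (W \<inter> V)" using chart_openin[OF c] V by (rule openin_Int)
  have "hol_at (dlog R V g (W, \<zeta>)) x" if x: "x \<in> W \<inter> V" for x
  proof (rule hol_at_cong)
    show "eventually (\<lambda>y. dlog R V g (W, \<zeta>) y = coord_deriv (W, \<zeta>) 1 g y / g y) (nhdsin X x)"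
      using eventually_in_open[OF o x] by (rule eventually_mono) (simp add: dlog_eq c)
    show "hol_at (\<lambda>y. coord_deriv (W, \<zeta>) 1 g y / g y) x"
      using x g by (intro hol_at_divide hol_at_coord_deriv[OF c]) auto
  qed
  then show "holo_on R (W \<inter> V) (dlog R V g (W, \<zeta>))"
    unfolding holo_on_iff[OF o] by blast
next
  fix W \<zeta> W' \<zeta>' x
  assume c: "coord_chart R (W, \<zeta>)" "coord_chart R (W', \<zeta>')" and x: "x \<in> W \<inter> W' \<inter> V"
  then have "coord_deriv (W, \<zeta>) 1 g x = coord_deriv (W', \<zeta>') 1 g x * coord_deriv (W, \<zeta>) 1 \<zeta>' x"
    using g(1) by (intro coord_deriv_chain) auto
  then show "dlog R V g (W, \<zeta>) x = dlog R V g (W', \<zeta>') x * coord_deriv (W, \<zeta>) 1 \<zeta>' x"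
    using c x by (simp add: dlog_eq del: One_nat_def)
qed

lemma logderiv_mult:
  assumes c: "coord_chart R (U, z)" "x \<in> U" and f: "hol_at f x" "f x \<noteq> 0" and g: "hol_at g x" "g x \<noteq> 0"
  shows "coord_deriv (U, z) 1 (\<lambda>y. f y * g y) x / (f x * g x) =
    coord_deriv (U, z) 1 f x / f x + coord_deriv (U, z) 1 g x / g x"
  unfolding coord_deriv_mult[OF c f(1) g(1)] using f g by (simp add: field_simps)

text \<open>Comparing two products covers both later uses: the relation between two systems of
  transition functions, and lambda_ij w_j = w_i times 1.\<close>

lemma logderiv_mult_eq:
  assumes c: "coord_chart R (U, z)" "x \<in> U" and S: "openin X S" "x \<in> S"
    and h: "\<And>k y. k \<in> {f, g, f', g'} \<Longrightarrow> y \<in> S \<Longrightarrow> hol_at k y \<and> k y \<noteq> 0"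
    and eq: "\<And>y. y \<in> S \<Longrightarrow> f y * g y = f' y * g' y"
  shows "coord_deriv (U, z) 1 f x / f x + coord_deriv (U, z) 1 g x / g x =
    coord_deriv (U, z) 1 f' x / f' x + coord_deriv (U, z) 1 g' x / g' x"
proof -
  have "coord_deriv (U, z) 1 (\<lambda>y. f y * g y) x = coord_deriv (U, z) 1 (\<lambda>y. f' y * g' y) x"
    by (rule coord_deriv_cong[OF c eventually_mono[OF eventually_in_open[OF S] eq]])
  moreover have "hol_at f x" "f x \<noteq> 0" "hol_at g x" "g x \<noteq> 0"
    "hol_at f' x" "f' x \<noteq> 0" "hol_at g' x" "g' x \<noteq> 0"
    using h[OF _ S(2)] by auto
  ultimately show ?thesis
    using logderiv_mult[OF c, of f g] logderiv_mult[OF c, of f' g'] eq[OF S(2)] by metis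
qed

lemma holo_formsD:
  assumes "\<omega> \<in> holo_forms R V"
  shows "\<not> (coord_chart R c \<and> x \<in> fst c \<inter> V) \<Longrightarrow> \<omega> c x = 0"
    and "coord_chart R (W, \<zeta>) \<Longrightarrow> holo_on R (W \<inter> V) (\<omega> (W, \<zeta>))"
    and "coord_chart R (W, \<zeta>) \<Longrightarrow> coord_chart R (W', \<zeta>') \<Longrightarrow> x \<in> W \<inter> W' \<inter> V \<Longrightarrow>
      \<omega> (W, \<zeta>) x = \<omega> (W', \<zeta>') x * coord_deriv (W, \<zeta>) 1 \<zeta>' x"
proof -
  note * = assms[unfolded holo_forms_def mem_Collect_eq]
  show "\<not> (coord_chart R c \<and> x \<in> fst c \<inter> V) \<Longrightarrow> \<omega> c x = 0"
    by (rule *[THEN conjunct1, rule_format])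
  show "coord_chart R (W, \<zeta>) \<Longrightarrow> holo_on R (W \<inter> V) (\<omega> (W, \<zeta>))"
    by (rule *[THEN conjunct2, THEN conjunct1, rule_format])
  show "coord_chart R (W, \<zeta>) \<Longrightarrow> coord_chart R (W', \<zeta>') \<Longrightarrow> x \<in> W \<inter> W' \<inter> V \<Longrightarrow>
      \<omega> (W, \<zeta>) x = \<omega> (W', \<zeta>') x * coord_deriv (W, \<zeta>) 1 \<zeta>' x"
    by (rule *[THEN conjunct2, THEN conjunct2, rule_format])
qed

lemma holo_forms_add:
  assumes V: "openin X V" and "\<omega> \<in> holo_forms R V" "\<eta> \<in> holo_forms R V"
  shows "form_add \<omega> \<eta> \<in> holo_forms R V"
proof -
  have o: "openin X (W \<inter> V)" if "coord_chart R (W, \<zeta>)" for W \<zeta>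
    using chart_openin[OF that] V by (rule openin_Int)
  show ?thesis
    unfolding holo_forms_def mem_Collect_eq form_add_def
  proof (intro conjI allI impI ballI)
    fix c x assume "\<not> (coord_chart R c \<and> x \<in> fst c \<inter> V)"
    then show "\<omega> c x + \<eta> c x = 0" using holo_formsD(1)[OF assms(2)] holo_formsD(1)[OF assms(3)] by auto
  next
    fix W \<zeta> assume c: "coord_chart R (W, \<zeta>)"
    show "holo_on R (W \<inter> V) (\<lambda>x. \<omega> (W, \<zeta>) x + \<eta> (W, \<zeta>) x)"
      using holo_formsD(2)[OF assms(2) c] holo_formsD(2)[OF assms(3) c] unfolding holo_on_iff[OF o[OF c]]
      by (intro ballI hol_at_add) auto
  next
    fix W \<zeta> W' \<zeta>' x
    assume h: "coord_chart R (W, \<zeta>)" "coord_chart R (W', \<zeta>')" "x \<in> W \<inter> W' \<inter> V"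
    show "\<omega> (W, \<zeta>) x + \<eta> (W, \<zeta>) x =
        (\<omega> (W', \<zeta>') x + \<eta> (W', \<zeta>') x) * coord_deriv (W, \<zeta>) 1 \<zeta>' x"
      unfolding distrib_right holo_formsD(3)[OF assms(2) h] holo_formsD(3)[OF assms(3) h] by (rule refl)
  qed
qed

text \<open>The relation gives d log f_ij = d log g_ij + d log h_j - d log h_i, so the two cochains
  differ by the coboundary of the forms d log h_i. The reverse inclusion comes from the functions 1
  / h_i.\<close>

lemma cech_class_subset:
  assumes U: "\<And>i. i \<in> I \<Longrightarrow> openin X (U i)"
    and h: "\<And>i x. i \<in> I \<Longrightarrow> x \<in> U i \<Longrightarrow> hol_at (h i) x \<and> h i x \<noteq> 0"
    and f: "\<And>i j x. i \<in> I \<Longrightarrow> j \<in> I \<Longrightarrow> x \<in> U i \<inter> U j \<Longrightarrow> hol_at (f i j) x \<and> f i j x \<noteq> 0"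
    and g: "\<And>i j x. i \<in> I \<Longrightarrow> j \<in> I \<Longrightarrow> x \<in> U i \<inter> U j \<Longrightarrow> hol_at (g i j) x \<and> g i j x \<noteq> 0"
    and eq: "\<And>i j x. i \<in> I \<Longrightarrow> j \<in> I \<Longrightarrow> x \<in> U i \<inter> U j \<Longrightarrow> h i x * f i j x = h j x * g i j x"
  shows "cech_class R I U (cochain I (\<lambda>i j. dlog R (U i \<inter> U j) (f i j)))
    \<subseteq> cech_class R I U (cochain I (\<lambda>i j. dlog R (U i \<inter> U j) (g i j)))"
proof
  let ?F = "cochain I (\<lambda>i j. dlog R (U i \<inter> U j) (f i j))"
  let ?G = "cochain I (\<lambda>i j. dlog R (U i \<inter> U j) (g i j))"
  let ?d = "\<lambda>\<eta>. cochain I (\<lambda>i j. form_diff (form_restrict (U i \<inter> U j) (\<eta> j))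
    (form_restrict (U i \<inter> U j) (\<eta> i)))"
  define \<theta> where "\<theta> i = dlog R (U i) (h i)" for i
  fix \<omega> assume "\<omega> \<in> cech_class R I U ?F"
  then obtain \<eta> where \<eta>: "\<And>i. i \<in> I \<Longrightarrow> \<eta> i \<in> holo_forms R (U i)"
    "\<omega> = (\<lambda>i j. form_add (?d \<eta> i j) (?F i j))"
    unfolding cech_class_def r_coset_def cech_B1_def cech_Z1_def by auto
  have "form_add (\<eta> i) (\<theta> i) \<in> holo_forms R (U i)" if "i \<in> I" for i
    unfolding \<theta>_def using U h \<eta>(1) that by (intro holo_forms_add dlog_in_holo_forms) auto
  moreover have "\<omega> = (\<lambda>i j. form_add (?d (\<lambda>i. form_add (\<eta> i) (\<theta> i)) i j) (?G i j))"
  proof (intro ext)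
    fix i j c x
    show "\<omega> i j c x = form_add (?d (\<lambda>i. form_add (\<eta> i) (\<theta> i)) i j) (?G i j) c x"
    proof (cases "i \<in> I \<and> j \<in> I \<and> coord_chart R c \<and> x \<in> fst c \<inter> (U i \<inter> U j)")
      case True
      then have ij: "i \<in> I" "j \<in> I" and x: "x \<in> U i \<inter> U j" by auto
      obtain V z where c: "c = (V, z)" "coord_chart R (V, z)" "x \<in> V" using True by (cases c) auto
      have "coord_deriv (V, z) 1 (h i) x / h i x + coord_deriv (V, z) 1 (f i j) x / f i j x =
          coord_deriv (V, z) 1 (h j) x / h j x + coord_deriv (V, z) 1 (g i j) x / g i j x"
        using U[OF ij(1)] U[OF ij(2)] h f g eq ij x
        by (intro logderiv_mult_eq[OF c(2,3) _ x]) auto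
      then show ?thesis
        using True c ij x
        by (simp add: \<eta>(2) cochain_def form_add_def form_diff_def form_restrict_def \<theta>_def dlog_eq
            algebra_simps del: One_nat_def)
    next
      \<comment> \<open>Here the logarithmic differentials are 0 by the normal form of forms and
        cochains, and the \<open>\<eta>\<close> terms agree.\<close>
      case False
      then show ?thesis
        by (auto simp: \<eta>(2) cochain_def form_add_def form_diff_def form_restrict_def \<theta>_def dlog_eq form_zero_def
            simp del: One_nat_def)
    qed
  qed
  ultimately show "\<omega> \<in> cech_class R I U ?G"
    unfolding cech_class_def r_coset_def cech_B1_def cech_Z1_def
    by (auto intro!: exI[of _ "\<lambda>i. form_add (\<eta> i) (\<theta> i)"])
qed

text \<open>Comparing arbitrary trivializations with those of the local equations gives functions
  h_i, so by \<open>cech_class_subset\<close> the definite description in \<open>chern_class\<close>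
  has exactly one candidate. \<open>lam\<close> is prescribed on overlaps only, so it may be
  computed from another section with the same quotients.\<close>

lemma chern_class_divisor:
  assumes k: "\<And>i. i \<in> I \<Longrightarrow> (U i, s i) \<in> local_equations R D"
    and lam: "\<And>i j x. i \<in> I \<Longrightarrow> j \<in> I \<Longrightarrow> x \<in> U i \<inter> U j \<Longrightarrow>
      lam i j x = mero_val R (\<lambda>y. s i y / s j y) x"
  shows "has_transition_functions R (divisor_line_bundle R D) I U lam"
    and "chern_class R I U (divisor_line_bundle R D) =
      cech_class R I U (cochain I (\<lambda>i j. dlog R (U i \<inter> U j) (lam i j)))"
proof -
  let ?L = "divisor_line_bundle R D"
  have U: "openin X (U i)" if "i \<in> I" for i
    using k[OF that] by (simp add: local_equations_def)
  have UU: "openin X (U i \<inter> U j)" if "i \<in> I" "j \<in> I" for i j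
    using U that by (intro openin_Int)
  have lam_nz: "hol_at (lam i j) x \<and> lam i j x \<noteq> 0" if ij: "i \<in> I" "j \<in> I" and x: "x \<in> U i \<inter> U j" for i j x
  proof
    have "hol_at (mero_val R (\<lambda>y. s i y / s j y)) x" "mero_val R (\<lambda>y. s i y / s j y) x \<noteq> 0"
      using local_equation_ratio[OF k[OF ij(1)] _ k[OF ij(2)]] x by blast+
    moreover have "eventually (\<lambda>y. lam i j y = mero_val R (\<lambda>y. s i y / s j y) y) (nhdsin X x)"
      by (rule eventually_mono[OF eventually_in_open[OF UU[OF ij] x] lam[OF ij]])
    ultimately show "hol_at (lam i j) x" "lam i j x \<noteq> 0"
      using hol_at_cong lam[OF ij x] by auto
  qed
  have trans: "divisor_triv (U i, s i) e = lam i j x \<cdot>\<^sub>v divisor_triv (U j, s j) e"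
    if "i \<in> I" "j \<in> I" "x \<in> U i \<inter> U j" "e \<in> fibre ?L x" for i j x e
    using divisor_triv_transition[OF k[OF that(1)] _ k[OF that(2)] _ that(4)] that(3) lam[OF that(1-3)]
    by auto
  show tf: "has_transition_functions R ?L I U lam"
    unfolding has_transition_functions_def
  proof (intro conjI exI[of _ "\<lambda>i. divisor_triv (U i, s i)"] ballI)
    show "holo_on R (U i \<inter> U j) (lam i j)" if "i \<in> I" "j \<in> I" for i j
      unfolding holo_on_iff[OF UU[OF that]] using lam_nz[OF that] by blast
  qed (use lam_nz divisor_triv_holo[OF k] trans in auto)
  have unique: "cech_class R I U (cochain I (\<lambda>i j. dlog R (U i \<inter> U j) (g i j))) =
      cech_class R I U (cochain I (\<lambda>i j. dlog R (U i \<inter> U j) (lam i j)))"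
    if g: "has_transition_functions R ?L I U g" for g
  proof -
    have g_nz: "hol_at (g i j) x \<and> g i j x \<noteq> 0" if "i \<in> I" "j \<in> I" "x \<in> U i \<inter> U j" for i j x
      using g that holo_on_iff[OF UU[OF that(1,2)]] unfolding has_transition_functions_def by blast
    obtain \<psi> where \<psi>: "\<And>i. i \<in> I \<Longrightarrow> holo_triv R 1 ?L (U i, \<psi> i)"
      "\<And>i j x e. i \<in> I \<Longrightarrow> j \<in> I \<Longrightarrow> x \<in> U i \<inter> U j \<Longrightarrow> e \<in> fibre ?L x \<Longrightarrow>
        \<psi> i e = g i j x \<cdot>\<^sub>v \<psi> j e"
      using g unfolding has_transition_functions_def by blast
    have "\<forall>i\<in>I. \<exists>h. \<forall>x\<in>U i. hol_at h x \<and> h x \<noteq> 0 \<and>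
        (\<forall>e\<in>fibre ?L x. \<psi> i e = h x \<cdot>\<^sub>v divisor_triv (U i, s i) e)"
    proof
      fix i assume i: "i \<in> I"
      have c: "triv_compatible R 1 ?L (U i, \<psi> i) (U i, divisor_triv (U i, s i))"
        using \<psi>(1)[OF i] divisor_triv_mem[OF k[OF i]] unfolding holo_triv_def by blast
      show "\<exists>h. \<forall>x\<in>U i. hol_at h x \<and> h x \<noteq> 0 \<and>
          (\<forall>e\<in>fibre ?L x. \<psi> i e = h x \<cdot>\<^sub>v divisor_triv (U i, s i) e)"
        by (rule triv_compatible_lineE[OF c UU[OF i i] divisor_triv_carrier]) blast
    qed
    from bchoice[OF this] obtain h where h: "\<And>i x. i \<in> I \<Longrightarrow> x \<in> U i \<Longrightarrow> hol_at (h i) x \<and> h i x \<noteq> 0"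
      "\<And>i x e. i \<in> I \<Longrightarrow> x \<in> U i \<Longrightarrow> e \<in> fibre ?L x \<Longrightarrow> \<psi> i e = h i x \<cdot>\<^sub>v divisor_triv (U i, s i) e"
      by blast
    \<comment> \<open>Evaluates \<open>\<psi> i\<close> in two ways on a fibre vector whose
      coordinate at j is 1.\<close>
    have eq: "h i x * lam i j x = h j x * g i j x" if ij: "i \<in> I" "j \<in> I" and x: "x \<in> U i \<inter> U j" for i j x
    proof -
      have "vec 1 (\<lambda>_. 1) \<in> divisor_triv (U j, s j) ` fibre ?L x"
        using divisor_triv_bij[OF k[OF ij(2)]] x unfolding bij_betw_def by auto
      then obtain e where e: "e \<in> fibre ?L x" "divisor_triv (U j, s j) e = vec 1 (\<lambda>_. 1)" by force
      have "\<psi> i e = h i x \<cdot>\<^sub>v (lam i j x \<cdot>\<^sub>v divisor_triv (U j, s j) e)"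
        using h(2)[OF ij(1) _ e(1)] trans[OF ij x e(1)] x by simp
      moreover have "\<psi> i e = g i j x \<cdot>\<^sub>v (h j x \<cdot>\<^sub>v divisor_triv (U j, s j) e)"
        using \<psi>(2)[OF ij x e(1)] h(2)[OF ij(2) _ e(1)] x by simp
      ultimately have "(h i x \<cdot>\<^sub>v (lam i j x \<cdot>\<^sub>v vec 1 (\<lambda>_. 1))) $ 0 =
          (g i j x \<cdot>\<^sub>v (h j x \<cdot>\<^sub>v (vec 1 (\<lambda>_. 1) :: complex vec))) $ 0"
        by (simp add: e(2))
      then show ?thesis by simp
    qed
    show ?thesis
    proof
      show "cech_class R I U (cochain I (\<lambda>i j. dlog R (U i \<inter> U j) (lam i j)))
          \<subseteq> cech_class R I U (cochain I (\<lambda>i j. dlog R (U i \<inter> U j) (g i j)))"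
        by (rule cech_class_subset[OF U h(1) lam_nz g_nz eq])
      show "cech_class R I U (cochain I (\<lambda>i j. dlog R (U i \<inter> U j) (g i j)))
          \<subseteq> cech_class R I U (cochain I (\<lambda>i j. dlog R (U i \<inter> U j) (lam i j)))"
      proof (rule cech_class_subset[OF U _ g_nz lam_nz])
        show "hol_at (\<lambda>x. 1 / h i x) x \<and> 1 / h i x \<noteq> 0" if "i \<in> I" "x \<in> U i" for i x
          using h(1)[OF that] hol_at_divide[OF hol_at_const, of x "h i"] hol_at_points by auto
        show "1 / h i x * g i j x = 1 / h j x * lam i j x" if "i \<in> I" "j \<in> I" "x \<in> U i \<inter> U j" for i j x
          using eq[OF that] h(1) that by (auto simp: field_simps)
      qed
    qed
  qed
  show "chern_class R I U ?L = cech_class R I U (cochain I (\<lambda>i j. dlog R (U i \<inter> U j) (lam i j)))"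
    unfolding chern_class_def using tf unique by (intro the_equality) blast+
qed

end

section \<open>Sections of a projectively flat bundle\<close>

locale proj_flat_bundle = riem_surface R for R :: "'a surface" +
  fixes n :: nat and E :: "('a, 'e) vbundle" and P :: "('a, 'e) triv set"
  assumes hol_bundle: "holomorphic_bundle R n E"
    and flat: "proj_flat_structure R n E P"
begin

lemma holo_triv_openin: "holo_triv R n E (U, \<phi>) \<Longrightarrow> openin X U"
  by (simp add: holo_triv_def is_triv_def)

lemma holo_triv_carrier:
  "holo_triv R n E (U, \<phi>) \<Longrightarrow> x \<in> U \<Longrightarrow> e \<in> fibre E x \<Longrightarrow> \<phi> e \<in> carrier_vec n"
  unfolding holo_triv_def is_triv_def by (auto dest: bij_betwE)

lemma section_fibre: "mero_section R n E A \<Longrightarrow> x \<in> points R \<Longrightarrow> A x \<in> fibre E x"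
  by (simp add: mero_section_def)

text \<open>\<open>mero_section\<close> tests only the members of \<open>trivs E\<close>; any other
  holomorphic trivialization differs from them by a matrix of holomorphic functions.\<close>

lemma section_mer_at:
  fixes \<phi> :: "'e \<Rightarrow> complex vec"
  assumes A: "mero_section R n E A" and t: "holo_triv R n E (U, \<phi>)" and x: "x \<in> U" and l: "l < n"
  shows "mer_at (\<lambda>y. \<phi> (A y) $ l) x"
proof -
  have U: "openin X U" using holo_triv_openin[OF t] .
  then have sub: "U \<subseteq> points R" by (rule openin_subset)
  have "x \<in> (\<Union>t\<in>trivs E. fst t)"
    using hol_bundle sub x unfolding holomorphic_bundle_def by blast
  then obtain V and \<psi> :: "'e \<Rightarrow> complex vec" where s: "(V, \<psi>) \<in> trivs E" "x \<in> V" by force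
  have V: "openin X V" "is_triv R n E (V, \<psi>)"
    using hol_bundle s(1) unfolding holomorphic_bundle_def is_triv_def by auto
  have "triv_compatible R n E (U, \<phi>) (V, \<psi>)"
    using t s(1) by (simp add: holo_triv_def)
  then obtain g where g: "\<And>y. y \<in> U \<inter> V \<Longrightarrow> g y \<in> carrier_mat n n"
      "\<And>y e. y \<in> U \<inter> V \<Longrightarrow> e \<in> fibre E y \<Longrightarrow> \<phi> e = transpose_mat (g y) *\<^sub>v \<psi> e"
      "\<And>k l. k < n \<Longrightarrow> l < n \<Longrightarrow> holo_on R (U \<inter> V) (\<lambda>x. g x $$ (k, l))"
    unfolding triv_compatible_def prod.case by blast
  have UV: "openin X (U \<inter> V)" using U V(1) by blast
  have eq: "\<phi> (A y) $ l = (\<Sum>r<n. g y $$ (r, l) * \<psi> (A y) $ r)" if y: "y \<in> U \<inter> V" for y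
  proof -
    have "A y \<in> fibre E y" using section_fibre[OF A] y sub by blast
    moreover from this have "\<psi> (A y) \<in> carrier_vec n"
      using V(2) y unfolding is_triv_def by (auto dest: bij_betwE)
    ultimately show ?thesis
      using g(1)[OF y] g(2)[OF y] l by (auto simp: scalar_prod_def lessThan_atLeast0 intro!: sum.cong)
  qed
  have "mer_at (\<lambda>y. \<Sum>r<n. g y $$ (r, l) * \<psi> (A y) $ r) x"
  proof (intro mer_at_sum mer_at_mult)
    show "x \<in> points R" using x sub by blast
    fix r assume r: "r \<in> {..<n}"
    then show "mer_at (\<lambda>y. g y $$ (r, l)) x"
      using g(3)[of r l] l x s(2) by (simp add: holo_on_iff[OF UV] hol_at_imp_mer_at)
    have "mero_on R V (\<lambda>y. \<psi> (A y) $ r)"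
      using A s(1) r unfolding mero_section_def by auto
    then show "mer_at (\<lambda>y. \<psi> (A y) $ r) x"
      using mero_on_iff[OF openin_subset[OF V(1)]] s(2) by blast
  qed
  moreover have "eventually (\<lambda>y. \<phi> (A y) $ l = (\<Sum>r<n. g y $$ (r, l) * \<psi> (A y) $ r)) (atin X x)"
    using x s(2) by (intro eventually_mono[OF eventually_nhdsin_imp_atin[OF eventually_in_open[OF UV]] eq]) auto
  ultimately show ?thesis by (rule mer_at_cong[rotated])
qed

text \<open>The factor h is found before the section A, hence is common to all sections. The second
  trivialization lies in P because \<open>proj_flat_triv\<close> gives relations to members of P
  only.\<close>

lemma wdet_flat_ratio:
  assumes c: "coord_chart R (U, z)" "x \<in> U" and d: "coord_chart R (V, w)" "x \<in> V"
    and t: "proj_flat_triv R n E P (U', \<phi>)" "x \<in> U'" and s: "(V', \<psi>) \<in> P" "x \<in> V'"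
  shows "\<exists>h. hol_at h x \<and> h x \<noteq> 0 \<and> (\<forall>A. mero_section R n E A \<longrightarrow>
    eventually (\<lambda>y. wdet n (U, z) \<phi> A y = h y * wdet n (V, w) \<psi> A y) (atin X x))"
proof -
  have ht: "holo_triv R n E (U', \<phi>)" "holo_triv R n E (V', \<psi>)"
    using t s flat by (auto simp: proj_flat_triv_def proj_flat_structure_def)
  have "proj_flat_related R n E (U', \<phi>) (V', \<psi>)"
    using t s by (auto simp: proj_flat_triv_def)
  then obtain \<mu> T where T: "T \<in> carrier_mat n n" "invertible_mat T"
    and \<mu>: "holo_on R (U' \<inter> V') \<mu>" "\<And>y. y \<in> U' \<inter> V' \<Longrightarrow> \<mu> y \<noteq> 0"
    and rel: "\<And>y e. y \<in> U' \<inter> V' \<Longrightarrow> e \<in> fibre E y \<Longrightarrow> \<phi> e = \<mu> y \<cdot>\<^sub>v (transpose_mat T *\<^sub>v \<psi> e)"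
    unfolding proj_flat_related_def prod.case by blast
  note oU = ht[THEN holo_triv_openin]
  have o: "openin X (U' \<inter> V')" using oU by blast
  have h\<mu>: "hol_at \<mu> y" if "y \<in> U' \<inter> V'" for y
    using \<mu>(1) that holo_on_iff[OF o] by blast
  \<comment> \<open>The determinant of the triangular change matrix times that of the constant
    matrix, as in \<open>wdet_change\<close>.\<close>
  define h where "h y = (\<Prod>k<n. \<mu> y * coord_deriv (U, z) 1 w y ^ k) * det T" for y
  have pt: "x \<in> points R" using chart_points[OF c] .
  have detT: "det T \<noteq> 0" by (rule invertible_mat_det_nonzero[OF T])
  have "hol_at h x"
    unfolding h_def[abs_def]
    using pt h\<mu>[of x] t s hol_at_coord_deriv[OF c hol_at_chart_fun[OF d], of 1]
    by (intro hol_at_mult hol_at_prod hol_at_power hol_at_const) auto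
  moreover have "h x \<noteq> 0"
    using detT \<mu>(2)[of x] t s coord_deriv_chart_nonzero[OF c d] by (simp add: h_def)
  moreover have "eventually (\<lambda>y. wdet n (U, z) \<phi> A y = h y * wdet n (V, w) \<psi> A y) (atin X x)"
    if A: "mero_section R n E A" for A
  proof -
    have "eventually (\<lambda>y. \<forall>l\<in>{..<n}. hol_at (\<lambda>y. \<psi> (A y) $ l) y) (atin X x)"
      using section_mer_at[OF A ht(2) s(2)] by (intro eventually_ball_finite) (auto intro: mer_at_hol_nearby)
    then obtain N where N: "openin X N" "x \<in> N" "openin X (N - {x})"
      "\<And>y l. y \<in> N - {x} \<Longrightarrow> l < n \<Longrightarrow> hol_at (\<lambda>y. \<psi> (A y) $ l) y"
      by (rule punctured_nhd[OF _ pt]) auto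
    \<comment> \<open>The components of A may have a pole at x, so x is removed before the change
      formula is applied.\<close>
    define S where "S = U \<inter> V \<inter> (U' \<inter> V') \<inter> (N - {x})"
    have S: "openin X S"
      unfolding S_def using chart_openin[OF c(1)] chart_openin[OF d(1)] oU N(3) by (intro openin_Int)
    have fib: "A y \<in> fibre E y" if "y \<in> S" for y
      using section_fibre[OF A] openin_subset[OF S] that by blast
    have "wdet n (U, z) \<phi> A y = h y * wdet n (V, w) \<psi> A y" if y: "y \<in> S" for y
      unfolding h_def
    proof (rule wdet_change[OF c(1) d(1) S])
      show "S \<subseteq> U \<inter> V" by (auto simp: S_def)
      show "hol_at \<mu> y" if "y \<in> S" for y using that h\<mu> by (auto simp: S_def)
      show "hol_at (\<lambda>y. \<psi> (A y) $ r) y" if "r < n" "y \<in> S" for r y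
        using that N(4) by (auto simp: S_def)
      show "\<psi> (A y) \<in> carrier_vec n" if "y \<in> S" for y
        using holo_triv_carrier[OF ht(2) _ fib[OF that]] that by (auto simp: S_def)
      show "\<phi> (A y) = \<mu> y \<cdot>\<^sub>v (transpose_mat T *\<^sub>v \<psi> (A y))" if "y \<in> S" for y
        using rel fib[OF that] that by (auto simp: S_def)
    qed (use T y in auto)
    moreover have "eventually (\<lambda>y. y \<in> U \<inter> V \<inter> (U' \<inter> V') \<inter> N) (nhdsin X x)"
      using chart_openin[OF c(1)] chart_openin[OF d(1)] oU N(1,2) c d t s
      by (intro eventually_in_open openin_Int) auto
    ultimately show ?thesis
      unfolding eventually_atin_iff_nhdsin by (auto elim!: eventually_mono simp: S_def)
  qed
  ultimately show ?thesis by blast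
qed

text \<open>Two projectively flat trivializations are compared through a member of P around x: each
  determinant is a unit times the one computed with it.\<close>

lemma wdet_ratio:
  assumes c: "coord_chart R (U, z)" "x \<in> U" and d: "coord_chart R (V, w)" "x \<in> V"
    and t: "proj_flat_triv R n E P (U', \<phi>)" "x \<in> U'" and s: "proj_flat_triv R n E P (V', \<psi>)" "x \<in> V'"
  obtains h where "hol_at h x" "h x \<noteq> 0"
    "\<And>A. mero_section R n E A \<Longrightarrow>
      eventually (\<lambda>y. wdet n (U, z) \<phi> A y = h y * wdet n (V, w) \<psi> A y) (atin X x)"
proof -
  have "x \<in> (\<Union>t\<in>P. fst t)"
    using flat chart_points[OF c] unfolding proj_flat_structure_def by simp
  then obtain W \<tau> where W: "(W, \<tau>) \<in> P" "x \<in> W" by force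
  obtain f where f: "hol_at f x" "f x \<noteq> 0" "\<And>A. mero_section R n E A \<Longrightarrow>
      eventually (\<lambda>y. wdet n (U, z) \<phi> A y = f y * wdet n (U, z) \<tau> A y) (atin X x)"
    using wdet_flat_ratio[OF c c t W] by blast
  obtain g where g: "hol_at g x" "g x \<noteq> 0" "\<And>A. mero_section R n E A \<Longrightarrow>
      eventually (\<lambda>y. wdet n (V, w) \<psi> A y = g y * wdet n (U, z) \<tau> A y) (atin X x)"
    using wdet_flat_ratio[OF d c s W] by blast
  show thesis
  proof (rule that)
    show "hol_at (\<lambda>y. f y / g y) x" using f g by (intro hol_at_divide)
    show "f x / g x \<noteq> 0" using f g by simp
    fix A assume A: "mero_section R n E A"
    show "eventually (\<lambda>y. wdet n (U, z) \<phi> A y = f y / g y * wdet n (V, w) \<psi> A y) (atin X x)"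
      using f(3)[OF A] g(3)[OF A] eventually_nhdsin_imp_atin[OF hol_at_nonzero_nhds[OF g(1,2)]]
      by eventually_elim simp
  qed
qed

lemma wdet_mer_at:
  assumes "mero_section R n E A" "coord_chart R (U, z)" "x \<in> U"
    "proj_flat_triv R n E P (U', \<phi>)" "x \<in> U'"
  shows "mer_at (wdet n (U, z) \<phi> A) x"
  using assms by (intro mer_at_wdet section_mer_at[where U = U']) (auto simp: proj_flat_triv_def)

lemma flat_cover:
  assumes "x \<in> points R"
  obtains U z U' \<phi> where "coord_chart R (U, z)" "x \<in> U" "proj_flat_triv R n E P (U', \<phi>)" "x \<in> U'"
proof -
  obtain U z where c: "coord_chart R (U, z)" "x \<in> U" by (rule chart_cover[OF assms])
  have "x \<in> (\<Union>t\<in>P. fst t)"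
    using flat assms unfolding proj_flat_structure_def by simp
  then obtain W \<tau> where W: "(W, \<tau>) \<in> P" "x \<in> W" by force
  then have "proj_flat_triv R n E P (W, \<tau>)"
    using flat by (simp add: proj_flat_structure_def proj_flat_triv_def)
  with c W that show thesis by blast
qed

lemma triv_openin: "proj_flat_triv R n E P (U', \<phi>) \<Longrightarrow> openin X U'"
  unfolding proj_flat_triv_def using holo_triv_openin by blast

text \<open>Near each point the determinant is either identically zero or zero-free off the point.
  The two cases define disjoint open sets that cover the connected surface.\<close>

lemma generic_wdet_nonzero:
  assumes gen: "generic_section R n E P A"
    and c: "coord_chart R (U, z)" "x \<in> U" and t: "proj_flat_triv R n E P (U', \<phi>)" "x \<in> U'"
  shows "eventually (\<lambda>y. wdet n (U, z) \<phi> A y \<noteq> 0) (atin X x)"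
proof -
  have A: "mero_section R n E A" using gen by (simp add: generic_section_def)
  \<comment> \<open>The truth value \<open>b\<close> stands for either case, so that openness is
    shown once.\<close>
  define Q where "Q b x \<longleftrightarrow> (\<exists>U z U' \<phi>. coord_chart R (U, z) \<and> x \<in> U \<and>
      proj_flat_triv R n E P (U', \<phi>) \<and> x \<in> U' \<and>
      eventually (\<lambda>y. (wdet n (U, z) \<phi> A y = 0) = b) (atin X x))" for b x
  \<comment> \<open>A unit factor relates any two choices of chart and trivialization, so the case
    does not depend on them.\<close>
  have Q_all: "eventually (\<lambda>y. (wdet n (U, z) \<phi> A y = 0) = b) (atin X x)"
    if Q: "Q b x" and c: "coord_chart R (U, z)" "x \<in> U" and t: "proj_flat_triv R n E P (U', \<phi>)" "x \<in> U'"
    for b U z U' \<phi> x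
  proof -
    obtain V w V' \<psi> where d: "coord_chart R (V, w)" "x \<in> V" "proj_flat_triv R n E P (V', \<psi>)" "x \<in> V'"
      and ev: "eventually (\<lambda>y. (wdet n (V, w) \<psi> A y = 0) = b) (atin X x)"
      using Q unfolding Q_def by blast
    obtain h where h: "hol_at h x" "h x \<noteq> 0"
      "\<And>A. mero_section R n E A \<Longrightarrow>
        eventually (\<lambda>y. wdet n (U, z) \<phi> A y = h y * wdet n (V, w) \<psi> A y) (atin X x)"
      using wdet_ratio[OF c d(1,2) t d(3,4)] by metis
    show ?thesis
      using ev h(3)[OF A] eventually_nhdsin_imp_atin[OF hol_at_nonzero_nhds[OF h(1,2)]]
      by eventually_elim simp
  qed
  define D where "D b = {x \<in> points R. Q b x}" for b
  have "openin X (D b)" for b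
    unfolding openin_subopen[of _ "D b"]
  proof
    fix x assume "x \<in> D b"
    then have x: "x \<in> points R" "Q b x" by (auto simp: D_def)
    then obtain V w V' \<psi> where d: "coord_chart R (V, w)" "x \<in> V" "proj_flat_triv R n E P (V', \<psi>)" "x \<in> V'"
      and ev: "eventually (\<lambda>y. (wdet n (V, w) \<psi> A y = 0) = b) (atin X x)"
      unfolding Q_def by blast
    obtain N where N: "openin X N" "x \<in> N" "openin X (N - {x})"
      "\<And>y. y \<in> N - {x} \<Longrightarrow> (wdet n (V, w) \<psi> A y = 0) = b"
      by (rule punctured_nhd[OF ev x(1)]) blast
    let ?S = "N \<inter> (V \<inter> V')"
    have S: "openin X ?S"
      using N(1) chart_openin[OF d(1)] triv_openin[OF d(3)] by (intro openin_Int)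
    moreover have "y \<in> D b" if y: "y \<in> ?S" for y
    proof (cases "y = x")
      case True then show ?thesis using \<open>x \<in> D b\<close> by simp
    next
      case False
      have "eventually (\<lambda>y. y \<in> N - {x}) (atin X y)"
        using False y by (intro eventually_nhdsin_imp_atin eventually_in_open N(3)) auto
      then have "eventually (\<lambda>y. (wdet n (V, w) \<psi> A y = 0) = b) (atin X y)"
        by (rule eventually_mono) (rule N(4))
      then have "Q b y" unfolding Q_def using d y by blast
      then show ?thesis using y openin_subset[OF N(1)] by (auto simp: D_def)
    qed
    ultimately show "\<exists>T. openin X T \<and> x \<in> T \<and> T \<subseteq> D b" using N(2) d by blast
  qed
  moreover have "points R \<subseteq> D True \<union> D False"
  proof
    fix x assume x: "x \<in> points R"
    obtain U z U' \<phi> where c: "coord_chart R (U, z)" "x \<in> U" "proj_flat_triv R n E P (U', \<phi>)" "x \<in> U'"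
      by (rule flat_cover[OF x])
    have "Q True x \<or> Q False x"
      using mer_at_dichotomy[OF wdet_mer_at[OF A c]] c unfolding Q_def by auto
    then show "x \<in> D True \<union> D False" using x by (auto simp: D_def)
  qed
  moreover have "D True \<inter> D False = {}"
  proof (rule ccontr)
    assume "D True \<inter> D False \<noteq> {}"
    then obtain x where x: "x \<in> points R" "Q True x" "Q False x" by (auto simp: D_def)
    obtain U z U' \<phi> where c: "coord_chart R (U, z)" "x \<in> U" "proj_flat_triv R n E P (U', \<phi>)" "x \<in> U'"
      by (rule flat_cover[OF x(1)])
    have "eventually (\<lambda>y. False) (atin X x)"
      using Q_all[OF x(2) c] Q_all[OF x(3) c] by eventually_elim simp
    then show False using atin_neq_bot[OF x(1)] by (simp add: eventually_False)
  qed
  moreover have "D False \<noteq> {}"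
  proof -
    obtain U z \<phi> x where g: "coord_chart R (U, z)" "proj_flat_triv R n E P (U, \<phi>)" "x \<in> U"
      "wronskian R n (U, z) \<phi> A x \<noteq> 0"
      using gen unfolding generic_section_def by blast
    have x: "x \<in> points R" using chart_points g by blast
    \<comment> \<open>If the determinant vanished near x, its canonical representative would be 0 at
      x, contrary to the choice of x.\<close>
    have "\<not> eventually (\<lambda>y. wdet n (U, z) \<phi> A y = 0) (atin X x)"
    proof
      assume "eventually (\<lambda>y. wdet n (U, z) \<phi> A y = 0) (atin X x)"
      then have "mero_val R (wdet n (U, z) \<phi> A) x = mero_val R (\<lambda>_. 0) x"
        by (rule mero_val_cong)
      then show False using g(4) mero_val_hol[OF hol_at_const[OF x]] by (simp add: wronskian_eq)
    qed
    then have "Q False x"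
      using mer_at_dichotomy[OF wdet_mer_at[OF A g(1,3,2,3)]] g unfolding Q_def by auto
    then show ?thesis using x by (auto simp: D_def)
  qed
  ultimately have "D True = {}"
    using riemann unfolding riemann_surface_def connected_space_def by blast
  then have "Q False x"
    using \<open>points R \<subseteq> D True \<union> D False\<close> chart_points[OF c] by (auto simp: D_def)
  from Q_all[OF this c t] show ?thesis by simp
qed

text \<open>The relation dw/dz = p_1 w is proved at nearby points, since A itself may have a pole at
  x. As w is a unit at x, p_1 = w'/w has a removable singularity there and \<open>mero_val\<close>
  gives its value.\<close>

lemma wronskian_logderiv:
  fixes \<phi> :: "'e \<Rightarrow> complex vec"
  assumes gen: "generic_section R n E P A" and n: "n \<ge> 1"
    and c: "coord_chart R (U, z)" "x \<in> U" and t: "proj_flat_triv R n E P (U', \<phi>)" "x \<in> U'"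
    and p: "\<And>k. 1 \<le> k \<Longrightarrow> k \<le> n \<Longrightarrow> mer_at (p k) x"
    and ode: "\<And>l. l < n \<Longrightarrow> eventually (\<lambda>y.
      mero_val R (coord_deriv (U, z) n (\<lambda>y. \<phi> (A y) $ l)) y =
      mero_val R (\<lambda>v. \<Sum>k = 1..n. p k v * coord_deriv (U, z) (n - k) (\<lambda>y. \<phi> (A y) $ l) v) y) (atin X x)"
    and w: "hol_at (wronskian R n (U, z) \<phi> A) x" "wronskian R n (U, z) \<phi> A x \<noteq> 0"
  shows "coord_deriv (U, z) 1 (wronskian R n (U, z) \<phi> A) x =
    mero_val R (p 1) x * wronskian R n (U, z) \<phi> A x"
proof -
  let ?w = "wronskian R n (U, z) \<phi> A" and ?D = "coord_deriv (U, z) 1"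
  have A: "mero_section R n E A" using gen by (simp add: generic_section_def)
  have pt: "x \<in> points R" using chart_points[OF c] .
  have U: "eventually (\<lambda>y. y \<in> U) (atin X x)"
    using eventually_nhdsin_imp_atin[OF eventually_in_open[OF chart_openin[OF c(1)] c(2)]] .
  have a: "eventually (\<lambda>y. \<forall>l\<in>{..<n}. hol_at (\<lambda>y. \<phi> (A y) $ l) y) (atin X x)"
    using section_mer_at[OF A _ t(2)] t(1)
    by (intro eventually_ball_finite) (auto simp: proj_flat_triv_def intro!: mer_at_hol_nearby)
  have q: "eventually (\<lambda>y. \<forall>k\<in>{1..n}. hol_at (p k) y) (atin X x)"
    using p by (intro eventually_ball_finite) (auto intro!: mer_at_hol_nearby)
  have e: "eventually (\<lambda>y. \<forall>l\<in>{..<n}. mero_val R (coord_deriv (U, z) n (\<lambda>y. \<phi> (A y) $ l)) y =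
      mero_val R (\<lambda>v. \<Sum>k = 1..n. p k v * coord_deriv (U, z) (n - k) (\<lambda>y. \<phi> (A y) $ l) v) y) (atin X x)"
    using ode by (intro eventually_ball_finite) auto
  \<comment> \<open>The canonical and the raw determinant agree in a whole neighbourhood of each
    nearby point, so their derivatives agree too.\<close>
  have ww: "eventually (\<lambda>y. eventually (\<lambda>y. ?w y = wdet n (U, z) \<phi> A y) (nhdsin X y)) (atin X x)"
    unfolding wronskian_eq
    by (intro eventually_atin_nhdsin mero_val_eq_nearby wdet_mer_at[OF A c t] pt)
  have "eventually (\<lambda>y. ?D ?w y = p 1 y * ?w y) (atin X x)"
    using U a q e ww
  proof eventually_elim
    case (elim y)
    have y: "y \<in> points R" using chart_points[OF c(1) elim(1)] .
    note cy = c(1) elim(1)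
    have "?D ?w y = ?D (wdet n (U, z) \<phi> A) y"
      by (rule coord_deriv_cong[OF cy elim(5)])
    also have "\<dots> = p 1 y * wdet n (U, z) \<phi> A y"
    proof (rule coord_deriv_wdet[OF cy n])
      fix l assume l: "l < n"
      then show ha: "hol_at (\<lambda>y. \<phi> (A y) $ l) y" using elim(2) by simp
      have "mero_val R (coord_deriv (U, z) n (\<lambda>y. \<phi> (A y) $ l)) y =
          coord_deriv (U, z) n (\<lambda>y. \<phi> (A y) $ l) y"
        by (rule mero_val_hol[OF hol_at_coord_deriv[OF cy ha]])
      moreover have "mero_val R (\<lambda>v. \<Sum>k = 1..n. p k v * coord_deriv (U, z) (n - k) (\<lambda>y. \<phi> (A y) $ l) v) y =
          (\<Sum>k = 1..n. p k y * coord_deriv (U, z) (n - k) (\<lambda>y. \<phi> (A y) $ l) y)"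
        using elim(3) by (intro mero_val_hol hol_at_sum hol_at_mult hol_at_coord_deriv[OF cy ha] y) auto
      ultimately show "coord_deriv (U, z) n (\<lambda>y. \<phi> (A y) $ l) y =
          (\<Sum>k = 1..n. p k y * coord_deriv (U, z) (n - k) (\<lambda>y. \<phi> (A y) $ l) y)"
        using elim(4) l by simp
    qed
    also have "wdet n (U, z) \<phi> A y = ?w y"
      using eventually_nhdsin_self[OF elim(5) y] by simp
    finally show ?case .
  qed
  moreover have nz: "eventually (\<lambda>y. ?w y \<noteq> 0) (atin X x)"
    using eventually_nhdsin_imp_atin[OF hol_at_nonzero_nhds[OF w]] .
  ultimately have "eventually (\<lambda>y. p 1 y = ?D ?w y / ?w y) (atin X x)"
    by eventually_elim simp
  then have "mero_val R (p 1) x = mero_val R (\<lambda>y. ?D ?w y / ?w y) x"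
    by (rule mero_val_cong)
  also have "\<dots> = ?D ?w x / ?w x"
    using w by (intro mero_val_hol hol_at_divide hol_at_coord_deriv[OF c])
  finally show ?thesis using w(2) by simp
qed

section \<open>The canonical Wronskians as local equations\<close>

lemma wronskian_eventually:
  assumes A: "mero_section R n E A" and c: "coord_chart R (U, z)" "x \<in> U"
    and t: "proj_flat_triv R n E P (U', \<phi>)" "x \<in> U'"
  shows "eventually (\<lambda>y. wronskian R n (U, z) \<phi> A y = wdet n (U, z) \<phi> A y) (atin X x)"
  unfolding wronskian_eq by (rule mero_val_eq_nearby[OF wdet_mer_at[OF A c t]])

lemma wronskian_mer_at:
  assumes "mero_section R n E A" "coord_chart R (U, z)" "x \<in> U"
    "proj_flat_triv R n E P (U', \<phi>)" "x \<in> U'"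
  shows "mer_at (wronskian R n (U, z) \<phi> A) x"
  unfolding wronskian_eq by (rule mer_at_mero_val[OF wdet_mer_at[OF assms]])

lemma generic_wronskian_nonzero:
  assumes gen: "generic_section R n E P A" and c: "coord_chart R (U, z)" "x \<in> U"
    and t: "proj_flat_triv R n E P (U', \<phi>)" "x \<in> U'"
  shows "eventually (\<lambda>y. wronskian R n (U, z) \<phi> A y \<noteq> 0) (atin X x)"
proof -
  have A: "mero_section R n E A" using gen by (simp add: generic_section_def)
  show ?thesis
    using generic_wdet_nonzero[OF gen c t] wronskian_eventually[OF A c t] by eventually_elim simp
qed

lemma wronskian_ratio:
  assumes c: "coord_chart R (U, z)" "x \<in> U" and d: "coord_chart R (V, w)" "x \<in> V"
    and t: "proj_flat_triv R n E P (U', \<phi>)" "x \<in> U'" and s: "proj_flat_triv R n E P (V', \<psi>)" "x \<in> V'"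
  obtains h where "hol_at h x" "h x \<noteq> 0"
    "\<And>A. mero_section R n E A \<Longrightarrow> eventually (\<lambda>y. wronskian R n (U, z) \<phi> A y =
      h y * wronskian R n (V, w) \<psi> A y) (atin X x)"
proof -
  obtain h where h: "hol_at h x" "h x \<noteq> 0"
    "\<And>A. mero_section R n E A \<Longrightarrow>
      eventually (\<lambda>y. wdet n (U, z) \<phi> A y = h y * wdet n (V, w) \<psi> A y) (atin X x)"
    by (rule wdet_ratio[OF c d t s]) blast
  show thesis
  proof (rule that[OF h(1,2)])
    fix A assume A: "mero_section R n E A"
    show "eventually (\<lambda>y. wronskian R n (U, z) \<phi> A y = h y * wronskian R n (V, w) \<psi> A y) (atin X x)"
      using h(3)[OF A] wronskian_eventually[OF A c t] wronskian_eventually[OF A d s]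
      by eventually_elim simp
  qed
qed

text \<open>Each quotient agrees off x with the factor h of \<open>wronskian_ratio\<close>, which
  does not depend on the section.\<close>

lemma wronskian_quotient:
  assumes c: "coord_chart R (U, z)" "x \<in> U" and d: "coord_chart R (V, w)" "x \<in> V"
    and t: "proj_flat_triv R n E P (U', \<phi>)" "x \<in> U'" and s: "proj_flat_triv R n E P (V', \<psi>)" "x \<in> V'"
    and A: "generic_section R n E P A" and B: "generic_section R n E P B"
  shows "mero_val R (\<lambda>y. wronskian R n (U, z) \<phi> A y / wronskian R n (V, w) \<psi> A y) x =
    mero_val R (\<lambda>y. wronskian R n (U, z) \<phi> B y / wronskian R n (V, w) \<psi> B y) x"
proof -
  obtain h where h: "hol_at h x" "h x \<noteq> 0"
    "\<And>A. mero_section R n E A \<Longrightarrow> eventually (\<lambda>y. wronskian R n (U, z) \<phi> A y =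
      h y * wronskian R n (V, w) \<psi> A y) (atin X x)"
    by (rule wronskian_ratio[OF c d t s]) blast
  have "mero_val R (\<lambda>y. wronskian R n (U, z) \<phi> A y / wronskian R n (V, w) \<psi> A y) x = mero_val R h x"
    if A: "generic_section R n E P A" for A
  proof (rule mero_val_cong)
    have "mero_section R n E A" using A by (simp add: generic_section_def)
    from h(3)[OF this] generic_wronskian_nonzero[OF A d s]
    show "eventually (\<lambda>y. wronskian R n (U, z) \<phi> A y / wronskian R n (V, w) \<psi> A y = h y) (atin X x)"
      by eventually_elim simp
  qed
  from this[OF A] this[OF B] show ?thesis by simp
qed

text \<open>Replacing the chart and trivialization chosen in \<open>section_divisor\<close>
  multiplies the Wronskian by a unit, which keeps the order.\<close>

lemma section_divisor_eq:
  assumes gen: "generic_section R n E P A"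
    and c: "coord_chart R (U, z)" and t: "proj_flat_triv R n E P (U, \<phi>)" and x: "x \<in> U"
  shows "section_divisor R n E P A x = ord_at R (wronskian R n (U, z) \<phi> A) x"
proof -
  have A: "mero_section R n E A" using gen by (simp add: generic_section_def)
  let ?Q = "\<lambda>(V, w, \<psi>). coord_chart R (V, w) \<and> proj_flat_triv R n E P (V, \<psi>) \<and> x \<in> V"
  obtain V w \<psi> where s: "(SOME q. ?Q q) = (V, w, \<psi>)" by (rule prod_cases3)
  have "?Q (U, z, \<phi>)" using c t x by simp
  then have "?Q (SOME q. ?Q q)" by (rule someI)
  then have d: "coord_chart R (V, w)" "proj_flat_triv R n E P (V, \<psi>)" "x \<in> V" by (simp_all add: s)
  obtain h where h: "hol_at h x" "h x \<noteq> 0"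
    "\<And>A. mero_section R n E A \<Longrightarrow> eventually (\<lambda>y. wronskian R n (V, w) \<psi> A y =
      h y * wronskian R n (U, z) \<phi> A y) (atin X x)"
    by (rule wronskian_ratio[OF d(1,3) c x d(2,3) t x]) blast
  have "section_divisor R n E P A x = ord_at R (wronskian R n (V, w) \<psi> A) x"
    unfolding section_divisor_def s by simp
  also have "\<dots> = ord_at R (wronskian R n (U, z) \<phi> A) x"
    by (rule ord_at_mult_unit[OF wronskian_mer_at[OF A c x t x] generic_wronskian_nonzero[OF gen c x t x]
          h(1,2) h(3)[OF A]])
  finally show ?thesis .
qed

lemma wronskian_local_equation:
  assumes gen: "generic_section R n E P A"
    and c: "coord_chart R (U, z)" and t: "proj_flat_triv R n E P (U, \<phi>)"
  shows "(U, wronskian R n (U, z) \<phi> A) \<in> local_equations R (section_divisor R n E P A)"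
proof -
  have A: "mero_section R n E A" using gen by (simp add: generic_section_def)
  have "\<not> eventually (\<lambda>y. wronskian R n (U, z) \<phi> A y = 0) (atin X x)" if x: "x \<in> U" for x
  proof
    assume "eventually (\<lambda>y. wronskian R n (U, z) \<phi> A y = 0) (atin X x)"
    then have "eventually (\<lambda>y. False) (atin X x)"
      using generic_wronskian_nonzero[OF gen c x t x] by eventually_elim simp
    then show False using atin_neq_bot chart_points[OF c x] by (simp add: eventually_False)
  qed
  moreover have "mero_on R U (wronskian R n (U, z) \<phi> A)"
    unfolding mero_on_iff[OF openin_subset[OF chart_openin[OF c]]]
    using wronskian_mer_at[OF A c _ t] by blast
  ultimately show ?thesis
    using chart_openin[OF c] section_divisor_eq[OF gen c t] by (simp add: local_equations_def)
qed

end

section \<open>Transition functions and Chern class of the Wronskian bundle\<close>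

theorem mainTheorem3:
  fixes R :: "'a surface" and n :: nat
    and E :: "('a, 'e) vbundle" and P :: "('a, 'e) triv set" and A :: "'a \<Rightarrow> 'e"
    and I :: "'i set" and U :: "'i \<Rightarrow> 'a set" and z :: "'i \<Rightarrow> 'a \<Rightarrow> complex"
    and \<phi> :: "'i \<Rightarrow> 'e \<Rightarrow> complex vec" and p :: "'i \<Rightarrow> nat \<Rightarrow> 'a \<Rightarrow> complex"
  defines "w \<equiv> \<lambda>i. wronskian R n (U i, z i) (\<phi> i) A"
  defines "lam \<equiv> \<lambda>i j. mero_val R (\<lambda>x. w i x / w j x)"
  defines "\<omega> \<equiv> \<lambda>i j. form_diff (fun_diff R (U i \<inter> U j) (mero_val R (p i 1)) (z i))
                             (fun_diff R (U i \<inter> U j) (mero_val R (p j 1)) (z j))"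
  assumes "riemann_surface R"
    and "n \<ge> 1"
    and "holomorphic_bundle R n E"
    and "proj_flat_structure R n E P"
    and "generic_section R n E P A"
    and "(\<Union>i\<in>I. U i) = points R"
    and "\<And>i. i \<in> I \<Longrightarrow> connectedin (rs_top R) (U i)"
    and "\<And>i. i \<in> I \<Longrightarrow> coord_chart R (U i, z i)"
    and "\<And>i. i \<in> I \<Longrightarrow> proj_flat_triv R n E P (U i, \<phi> i)"
    and "\<And>i j x. i \<in> I \<Longrightarrow> j \<in> I \<Longrightarrow> i \<noteq> j \<Longrightarrow> x \<in> U i \<inter> U j \<Longrightarrow>
           section_divisor R n E P A x = 0"
    and "\<And>i k. i \<in> I \<Longrightarrow> 1 \<le> k \<Longrightarrow> k \<le> n \<Longrightarrow> mero_on R (U i) (p i k)"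
    and "\<And>i l x. i \<in> I \<Longrightarrow> l < n \<Longrightarrow> x \<in> U i \<Longrightarrow>
           mero_val R (coord_deriv (U i, z i) n (\<lambda>y. \<phi> i (A y) $ l)) x =
           mero_val R (\<lambda>v. \<Sum>k=1..n. p i k v *
             coord_deriv (U i, z i) (n - k) (\<lambda>y. \<phi> i (A y) $ l) v) x"
  shows "has_transition_functions R (wronskian_line_bundle R n E P) I U lam
       \<and> (\<forall>i\<in>I. \<forall>j\<in>I. dlog R (U i \<inter> U j) (lam i j) = \<omega> i j)
       \<and> cochain I \<omega> \<in> carrier (cech_Z1 R I U)
       \<and> chern_class R I U (wronskian_line_bundle R n E P) \<in> carrier (cech_H1 R I U)
       \<and> chern_class R I U (wronskian_line_bundle R n E P) = cech_class R I U (cochain I \<omega>)"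
proof -
  interpret proj_flat_bundle R n E P
    by unfold_locales fact+
  note n = assms(5) and gen = assms(8) and c = assms(11) and t = assms(12) and div = assms(13)
    and p = assms(14) and ode = assms(15)
  \<comment> \<open>The section fixed by the choice in \<open>wronskian_line_bundle\<close>,
    possibly different from A.\<close>
  define B where "B = (SOME A. generic_section R n E P A)"
  let ?L = "wronskian_line_bundle R n E P"
  have B: "generic_section R n E P B"
    unfolding B_def by (rule someI[of "generic_section R n E P", OF gen])
  have L: "?L = divisor_line_bundle R (section_divisor R n E P B)"
    by (simp add: wronskian_line_bundle_def B_def)
  have U: "openin X (U i)" if "i \<in> I" for i using chart_openin[OF c[OF that]] .
  have UU: "openin X (U i \<inter> U j)" if "i \<in> I" "j \<in> I" for i j using U that by (intro openin_Int)
  have k: "(U i, wronskian R n (U i, z i) (\<phi> i) B) \<in> local_equations R (section_divisor R n E P B)"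
    if "i \<in> I" for i
    by (rule wronskian_local_equation[OF B c[OF that] t[OF that]])
  have lamB: "lam i j x = mero_val R (\<lambda>y. wronskian R n (U i, z i) (\<phi> i) B y /
      wronskian R n (U j, z j) (\<phi> j) B y) x"
    if "i \<in> I" "j \<in> I" "x \<in> U i \<inter> U j" for i j x
    unfolding lam_def w_def
    using that by (intro wronskian_quotient[OF c _ c _ t _ t _ gen B]) auto
  have tf: "has_transition_functions R ?L I U lam"
    and ch: "chern_class R I U ?L = cech_class R I U (cochain I (\<lambda>i j. dlog R (U i \<inter> U j) (lam i j)))"
    unfolding L using chern_class_divisor[where s = "\<lambda>i. wronskian R n (U i, z i) (\<phi> i) B", OF k lamB]
    by blast+
  have lam_hol: "hol_at (lam i j) x" and lam_nz: "lam i j x \<noteq> 0"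
    if "i \<in> I" "j \<in> I" "x \<in> U i \<inter> U j" for i j x
    using tf that holo_on_iff[OF UU[OF that(1,2)]] unfolding has_transition_functions_def by blast+
  have w: "hol_at (w i) x" "w i x \<noteq> 0"
    and logw: "\<And>V \<zeta>. coord_chart R (V, \<zeta>) \<Longrightarrow> x \<in> V \<Longrightarrow>
      coord_deriv (V, \<zeta>) 1 (w i) x / w i x = mero_val R (p i 1) x * coord_deriv (V, \<zeta>) 1 (z i) x"
    if i: "i \<in> I" "x \<in> U i" and D: "section_divisor R n E P A x = 0" for i x
  proof -
    note ci = c[OF i(1)] i(2) and ti = t[OF i(1)] i(2)
    have A: "mero_section R n E A" using gen by (simp add: generic_section_def)
    have pt: "x \<in> points R" using chart_points[OF ci] .
    have o: "ord_at R (w i) x = 0"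
      using section_divisor_eq[OF gen c[OF i(1)] t[OF i(1)] i(2)] D by (simp add: w_def)
    have wm: "mer_at (w i) x" "eventually (\<lambda>y. w i y \<noteq> 0) (atin X x)"
      unfolding w_def by (rule wronskian_mer_at[OF A ci ti] generic_wronskian_nonzero[OF gen ci ti])+
    \<comment> \<open>\<open>w i\<close> is already a canonical representative, so
      \<open>mero_val\<close> leaves it unchanged and order 0 makes \<open>w i\<close> itself a unit
      at x.\<close>
    have "mero_val R (w i) y = w i y" if y: "y \<in> U i" for y
    proof -
      have "eventually (\<lambda>v. w i v = wdet n (U i, z i) (\<phi> i) A v) (atin X y)"
        unfolding w_def by (rule wronskian_eventually[OF A c[OF i(1)] y t[OF i(1)] y])
      from mero_val_cong[OF this] show ?thesis by (simp add: w_def wronskian_eq)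
    qed
    then have "eventually (\<lambda>y. w i y = mero_val R (w i) y) (nhdsin X x)"
      using eventually_in_open[OF U[OF i(1)] i(2)] by (auto elim: eventually_mono)
    moreover note hol_at_mero_val_ord_0[OF wm o]
    ultimately show w: "hol_at (w i) x" "w i x \<noteq> 0"
      using hol_at_cong eventually_nhdsin_self[OF _ pt] by force+
    have lw: "coord_deriv (U i, z i) 1 (w i) x = mero_val R (p i 1) x * w i x"
      unfolding w_def
    proof (rule wronskian_logderiv[OF gen n ci ti])
      show "mer_at (p i k) x" if "1 \<le> k" "k \<le> n" for k
        using p[OF i(1) that] i(2) mero_on_iff[OF openin_subset[OF U[OF i(1)]]] by blast
      show "eventually (\<lambda>y. mero_val R (coord_deriv (U i, z i) n (\<lambda>y. \<phi> i (A y) $ l)) y =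
          mero_val R (\<lambda>v. \<Sum>k=1..n. p i k v * coord_deriv (U i, z i) (n - k) (\<lambda>y. \<phi> i (A y) $ l) v) y)
          (atin X x)" if "l < n" for l
        using eventually_nhdsin_imp_atin[OF eventually_in_open[OF U[OF i(1)] i(2)]]
        by (rule eventually_mono) (rule ode[OF i(1) that])
    qed (use w in \<open>simp_all add: w_def\<close>)
    \<comment> \<open>A form is tested in an arbitrary chart, while p_1^i refers to z_i; the chain
      rule supplies the factor dz_i.\<close>
    fix V \<zeta> assume d: "coord_chart R (V, \<zeta>)" "x \<in> V"
    show "coord_deriv (V, \<zeta>) 1 (w i) x / w i x = mero_val R (p i 1) x * coord_deriv (V, \<zeta>) 1 (z i) x"
      unfolding coord_deriv_chain[OF d ci w(1)] lw using w(2) by simp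
  qed
  have dlog_lam: "dlog R (U i \<inter> U j) (lam i j) = \<omega> i j" if ij: "i \<in> I" "j \<in> I" for i j
  proof (intro ext)
    fix d x
    show "dlog R (U i \<inter> U j) (lam i j) d x = \<omega> i j d x"
    proof (cases "coord_chart R d \<and> x \<in> fst d \<inter> (U i \<inter> U j)")
      case False
      then show ?thesis by (auto simp: dlog_eq \<omega>_def form_diff_def fun_diff_def)
    next
      case True
      then obtain V \<zeta> where d: "d = (V, \<zeta>)" "coord_chart R (V, \<zeta>)" "x \<in> V" by (cases d) auto
      have x: "x \<in> U i \<inter> U j" using True by blast
      have \<omega>: "\<omega> i j d x = mero_val R (p i 1) x * coord_deriv (V, \<zeta>) 1 (z i) x -
          mero_val R (p j 1) x * coord_deriv (V, \<zeta>) 1 (z j) x"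
        using True d by (simp add: \<omega>_def form_diff_def fun_diff_def)
      have dl: "dlog R (U i \<inter> U j) (lam i j) d x = coord_deriv (V, \<zeta>) 1 (lam i j) x / lam i j x"
        using True d by (simp add: dlog_eq)
      show ?thesis
      proof (cases "i = j")
        \<comment> \<open>The overlap is all of U_i, where w may have zeros or poles. Here lambda is
          the constant 1 and the two forms cancel.\<close>
        case eq: True
        have "lam i i y = 1" if y: "y \<in> U i" for y
          using lamB[OF ij(1) ij(1)] local_equation_self[OF k[OF ij(1)] y] y by simp
        then have "eventually (\<lambda>y. lam i i y = 1) (nhdsin X x)"
          using x by (intro eventually_mono[OF eventually_in_open[OF U[OF ij(1)]]]) auto
        then have "coord_deriv (V, \<zeta>) 1 (lam i i) x = coord_deriv (V, \<zeta>) 1 (\<lambda>_. 1) x"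
          by (rule coord_deriv_cong[OF d(2,3)])
        then show ?thesis unfolding \<omega> dl using eq by simp
      next
        case False
        have w_ij: "hol_at (w i) y \<and> w i y \<noteq> 0" "hol_at (w j) y \<and> w j y \<noteq> 0"
          if "y \<in> U i \<inter> U j" for y
          using w[OF ij(1) _ div[OF ij False that]] w[OF ij(2) _ div[OF ij False that]] that by auto
        \<comment> \<open>The factor 1 brings the relation into the shape of
          \<open>logderiv_mult_eq\<close>.\<close>
        have "lam i j y * w j y = w i y * 1" if y: "y \<in> U i \<inter> U j" for y
        proof -
          have "lam i j y = w i y / w j y"
            unfolding lam_def using w_ij[OF y] by (intro mero_val_hol hol_at_divide) auto
          then show ?thesis using w_ij[OF y] by simp
        qed
        then have "coord_deriv (V, \<zeta>) 1 (lam i j) x / lam i j x + coord_deriv (V, \<zeta>) 1 (w j) x / w j x =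
            coord_deriv (V, \<zeta>) 1 (w i) x / w i x + coord_deriv (V, \<zeta>) 1 (\<lambda>_. 1) x / 1"
          using w_ij lam_hol[OF ij] lam_nz[OF ij] openin_subset[OF UU[OF ij]]
          by (intro logderiv_mult_eq[OF d(2,3) UU[OF ij] x]) auto
        then show ?thesis
          unfolding \<omega> dl
          using logw[OF ij(1) _ div[OF ij False x] d(2,3)] logw[OF ij(2) _ div[OF ij False x] d(2,3)] x
          by (simp add: algebra_simps)
      qed
    qed
  qed
  have co: "cochain I (\<lambda>i j. dlog R (U i \<inter> U j) (lam i j)) = cochain I \<omega>"
    by (intro ext) (simp add: cochain_def dlog_lam)
  have Z1: "cochain I \<omega> \<in> carrier (cech_Z1 R I U)"
  proof -
    \<comment> \<open>Each p_1^i dz_i may have poles on U_i; holomorphy of the difference on the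
      overlap comes from its equality with d log lambda_ij.\<close>
    have "\<omega> i j \<in> holo_forms R (U i \<inter> U j)" if "i \<in> I" "j \<in> I" for i j
      unfolding dlog_lam[OF that, symmetric]
      using lam_hol[OF that] lam_nz[OF that] by (intro dlog_in_holo_forms UU that) auto
    \<comment> \<open>The cocycle relation is formal: the terms of index j cancel.\<close>
    moreover have "form_add (form_restrict V (\<omega> i j)) (form_restrict V (\<omega> j l)) = form_restrict V (\<omega> i l)"
      if "V = U i \<inter> U j \<inter> U l" for V i j l
      unfolding \<omega>_def form_add_def form_restrict_def form_diff_def fun_diff_def that
      by (intro ext) auto
    ultimately show ?thesis
      by (simp add: cech_Z1_def cochain_def Let_def)
  qed
  have "cech_class R I U (cochain I \<omega>) \<in> carrier (cech_H1 R I U)"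
    using Z1 unfolding cech_class_def cech_H1_def FactGroup_def RCOSETS_def by auto
  with tf dlog_lam Z1 ch[unfolded co] show ?thesis by simp
qed

end
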